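(* Let $G$ be a supramenable group and $R$ a ring with a boundedly free $G$-grading. Then $R$ has UGN if and only if $R_1$ has UGN.
   Context: Rings are unital; "module" means right module unless stated otherwise. A ring $S$ has unbounded generating number (UGN) if, for every positive integer $n$, there is no $S$-module epimorphism $S^n\to S^{n+1}$. $S^0$ denotes the zero module. A $G$-grading on a ring $R$ ($G$ a group) is a family of additive subgroups $R_g$ ($g\in G$) with $R=\bigoplus_{g\in G}R_g$ as additive groups and $R_gR_h\subseteq R_{gh}$ for all $g,h\in G$; $R_1$ is the subring that is the component of the identity of $G$. The grading is boundedly free if there is a positive integer $r$ such that at least one of the following holds: (a) for each $g\in G$ there is an integer $i\in[0,r]$ with $R_g\cong (R_1)^i$ as right $R_1$-modules; (b) for each $g\in G$ there is an integer $i\in[0,r]$ with $R_g\cong (R_1)^i$ as left $R_1$-modules. A subset $X$ of a group $G$ is amenable with respect to $G$ if there is a function $\mu:\mathcal P(G)\to[0,\infty]$ such that $\mu(A\cup B)=\mu(A)+\mu(B)$ for all disjoint $A,B\subseteq G$, $\mu(gA)=\mu(A)$ for all $A\subseteq G$ and $g\in G$, and $\mu(X)=1$. A group $G$ is supramenable if every nonempty subset of $G$ is amenable with respect to $G$. *)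

theory Defs
  imports "HOL-Algebra.Algebra" "HOL-Library.Extended_Nonnegative_Real" "HOL-Library.FuncSet"
begin

(* The library locale "module" requires a commutative ring, so modules over a
   noncommutative ring are presented here by the library record type "module", which
   carries no axioms.  For a right module, the field smult is the right action:
   a \<odot> x stands for x a.  The ring-multiplication fields mult and one of the record
   play no role for modules and are left undefined. *)

definition linear_maps ::
  "('r, 'k) ring_scheme \<Rightarrow> ('r, 'm, 'p) module_scheme \<Rightarrow> ('r, 'n, 'q) module_scheme \<Rightarrow> ('m \<Rightarrow> 'n) set"
  where "linear_maps S M N =
    {f \<in> carrier M \<rightarrow> carrier N.
      (\<forall>x \<in> carrier M. \<forall>y \<in> carrier M. f (x \<oplus>\<^bsub>M\<^esub> y) = f x \<oplus>\<^bsub>N\<^esub> f y) \<and>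
      (\<forall>a \<in> carrier S. \<forall>x \<in> carrier M. f (a \<odot>\<^bsub>M\<^esub> x) = a \<odot>\<^bsub>N\<^esub> f x)}"

definition module_epis ::
  "('r, 'k) ring_scheme \<Rightarrow> ('r, 'm, 'p) module_scheme \<Rightarrow> ('r, 'n, 'q) module_scheme \<Rightarrow> ('m \<Rightarrow> 'n) set"
  where "module_epis S M N = {f \<in> linear_maps S M N. f ` carrier M = carrier N}"

definition module_isomorphic ::
  "('r, 'k) ring_scheme \<Rightarrow> ('r, 'm, 'p) module_scheme \<Rightarrow> ('r, 'n, 'q) module_scheme \<Rightarrow> bool"
  where "module_isomorphic S M N \<longleftrightarrow>
    (\<exists>f \<in> linear_maps S M N. bij_betw f (carrier M) (carrier N))"

(* For n = 0 the carrier of a power consists of the single function with empty domain. *)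

definition right_power :: "('r, 'k) ring_scheme \<Rightarrow> nat \<Rightarrow> ('r, nat \<Rightarrow> 'r) module"
  where "right_power S n =
    \<lparr>carrier = {..<n} \<rightarrow>\<^sub>E carrier S, monoid.mult = undefined, monoid.one = undefined,
     ring.zero = (\<lambda>i\<in>{..<n}. \<zero>\<^bsub>S\<^esub>),
     ring.add = (\<lambda>x y. \<lambda>i\<in>{..<n}. x i \<oplus>\<^bsub>S\<^esub> y i),
     smult = (\<lambda>a x. \<lambda>i\<in>{..<n}. x i \<otimes>\<^bsub>S\<^esub> a)\<rparr>"

definition left_power :: "('r, 'k) ring_scheme \<Rightarrow> nat \<Rightarrow> ('r, nat \<Rightarrow> 'r) module"
  where "left_power S n =
    \<lparr>carrier = {..<n} \<rightarrow>\<^sub>E carrier S, monoid.mult = undefined, monoid.one = undefined,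
     ring.zero = (\<lambda>i\<in>{..<n}. \<zero>\<^bsub>S\<^esub>),
     ring.add = (\<lambda>x y. \<lambda>i\<in>{..<n}. x i \<oplus>\<^bsub>S\<^esub> y i),
     smult = (\<lambda>a x. \<lambda>i\<in>{..<n}. a \<otimes>\<^bsub>S\<^esub> x i)\<rparr>"

definition UGN :: "('r, 'k) ring_scheme \<Rightarrow> bool"
  where "UGN S \<longleftrightarrow>
    (\<forall>n>0. module_epis S (right_power S n) (right_power S (Suc n)) = {})"

(* The last clause says that R is the internal direct sum of the components: every
   element is the sum of exactly one finitely supported family of components. *)

definition group_grading ::
  "('g, 'h) monoid_scheme \<Rightarrow> ('r, 'k) ring_scheme \<Rightarrow> ('g \<Rightarrow> 'r set) \<Rightarrow> bool"
  where "group_grading G R A \<longleftrightarrow>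
    (\<forall>g \<in> carrier G. additive_subgroup (A g) R) \<and>
    (\<forall>g \<in> carrier G. \<forall>h \<in> carrier G. \<forall>a \<in> A g. \<forall>b \<in> A h.
       a \<otimes>\<^bsub>R\<^esub> b \<in> A (g \<otimes>\<^bsub>G\<^esub> h)) \<and>
    (\<forall>x \<in> carrier R. \<exists>!f. f \<in> (\<Pi>\<^sub>E g\<in>carrier G. A g) \<and>
       finite {g \<in> carrier G. f g \<noteq> \<zero>\<^bsub>R\<^esub>} \<and>
       x = (\<Oplus>\<^bsub>R\<^esub>g\<in>{g \<in> carrier G. f g \<noteq> \<zero>\<^bsub>R\<^esub>}. f g))"

definition identity_component ::
  "('g, 'h) monoid_scheme \<Rightarrow> ('r, 'k) ring_scheme \<Rightarrow> ('g \<Rightarrow> 'r set) \<Rightarrow> ('r, 'k) ring_scheme"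
  where "identity_component G R A = R\<lparr>carrier := A \<one>\<^bsub>G\<^esub>\<rparr>"

(* An additive subgroup B of R, with scalars acting by multiplication in R on the
   right or on the left. *)

definition right_component :: "('r, 'k) ring_scheme \<Rightarrow> 'r set \<Rightarrow> ('r, 'r) module"
  where "right_component R B =
    \<lparr>carrier = B, monoid.mult = undefined, monoid.one = undefined,
     ring.zero = \<zero>\<^bsub>R\<^esub>, ring.add = ring.add R,
     smult = (\<lambda>a x. x \<otimes>\<^bsub>R\<^esub> a)\<rparr>"

definition left_component :: "('r, 'k) ring_scheme \<Rightarrow> 'r set \<Rightarrow> ('r, 'r) module"
  where "left_component R B =
    \<lparr>carrier = B, monoid.mult = undefined, monoid.one = undefined,
     ring.zero = \<zero>\<^bsub>R\<^esub>, ring.add = ring.add R,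
     smult = (\<lambda>a x. a \<otimes>\<^bsub>R\<^esub> x)\<rparr>"

definition boundedly_free ::
  "('g, 'h) monoid_scheme \<Rightarrow> ('r, 'k) ring_scheme \<Rightarrow> ('g \<Rightarrow> 'r set) \<Rightarrow> bool"
  where "boundedly_free G R A \<longleftrightarrow>
    (let S = identity_component G R A in
     \<exists>r::nat. r > 0 \<and>
      ((\<forall>g \<in> carrier G. \<exists>i\<in>{0..r}.
          module_isomorphic S (right_component R (A g)) (right_power S i)) \<or>
       (\<forall>g \<in> carrier G. \<exists>i\<in>{0..r}.
          module_isomorphic S (left_component R (A g)) (left_power S i))))"

definition amenable_subset :: "('g, 'h) monoid_scheme \<Rightarrow> 'g set \<Rightarrow> bool"
  where "amenable_subset G Y \<longleftrightarrow>
    (\<exists>\<mu> :: 'g set \<Rightarrow> ennreal.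
      (\<forall>A B. A \<subseteq> carrier G \<longrightarrow> B \<subseteq> carrier G \<longrightarrow> A \<inter> B = {} \<longrightarrow>
         \<mu> (A \<union> B) = \<mu> A + \<mu> B) \<and>
      (\<forall>A g. A \<subseteq> carrier G \<longrightarrow> g \<in> carrier G \<longrightarrow> \<mu> (g <#\<^bsub>G\<^esub> A) = \<mu> A) \<and>
      \<mu> Y = 1)"

definition supramenable :: "('g, 'h) monoid_scheme \<Rightarrow> bool"
  where "supramenable G \<longleftrightarrow>
    (\<forall>Y. Y \<subseteq> carrier G \<longrightarrow> Y \<noteq> {} \<longrightarrow> amenable_subset G Y)"

end

theory Submission
  imports Defs
begin

text \<open>
If \<open>S\<close> is the identity component of \<open>R\<close>, then \<open>R\<close> fails to have unbounded generating number if and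
only if for some positive \<open>n\<close> the identity matrix of size \<open>n + 1\<close> is a product \<open>F H\<close> of an
\<open>(n + 1) \<times> n\<close> and an \<open>n \<times> (n + 1)\<close> matrix over \<open>R\<close> (\<open>UGN_iff_identity_factors\<close>). Such a
factorization over \<open>S\<close> is one over \<open>R\<close>, so that the property passes from \<open>R\<close> to \<open>S\<close>.

For the converse, suppose that \<open>S\<close> has unbounded generating number and that \<open>F H\<close> is such a
factorization over \<open>R\<close>. Let the components be free right \<open>S\<close>-modules, the one of degree \<open>g\<close> being of
rank \<open>\<rho> g \<le> r\<close>, and write \<open>\<rho>(Y)\<close> for the sum of the ranks over a finite set \<open>Y\<close> of degrees. If the
finite set \<open>L\<close> contains the supports of the entries of \<open>H\<close>, then the columns of length \<open>n\<close> with
support in \<open>L Y\<close> map onto the columns of length \<open>n + 1\<close> with support in \<open>Y\<close> by an \<open>S\<close>-linear map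
(\<open>identity_factors_descend\<close>), whence \<open>(n + 1) \<rho>(Y) \<le> n \<rho>(L Y)\<close>.
Iterating gives a finite set \<open>M\<close> with \<open>2 r \<rho>(Y) \<le> \<rho>(M Y)\<close> for all
finite \<open>Y\<close>. On the nonempty set \<open>V\<close> of degrees with nonzero rank this implies that \<open>M Y \<inter> V\<close> has at
least twice as many elements as \<open>Y\<close>, for every finite subset \<open>Y\<close> of \<open>V\<close>. By Hall's theorem for infinite
families of finite sets (\<open>infinite_hall\<close>), \<open>V\<close> is then paradoxical and so not amenable
(\<open>doubling_not_amenable\<close>), against supramenability.

If the components are free left modules instead, the argument applies to the opposite ring, graded by
the opposite group: transposition of matrices shows that the unbounded generating number is a
left-right symmetric property, and inversion shows the same for supramenability.
\<close>

section \<open>Systems of distinct representatives\<close>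

text \<open>
Hall's condition for a relation between an index set \<open>I\<close> and arbitrary values: every finite set of
indices has at least as many values related to it as it has elements.
\<close>

definition hall_relation :: "'i set \<Rightarrow> ('i \<times> 'a) set \<Rightarrow> bool"
  where "hall_relation I D \<longleftrightarrow> (\<forall>J. finite J \<longrightarrow> J \<subseteq> I \<longrightarrow> card J \<le> card (D `` J))"

text \<open>
Zorn's lemma is applied to the sets of removed pairs. Hall's condition survives the union of a chain
because only finitely many pairs start in a given finite set of indices, and those of them that
lie in the union already lie in a single member of the chain.
\<close>

lemma hall_relation_minimal:
  assumes D: "hall_relation I D" and fin: "\<And>i. i \<in> I \<Longrightarrow> finite (D `` {i})"
  obtains M where "M \<subseteq> D" "hall_relation I M"
    "\<And>e. e \<in> M \<Longrightarrow> \<not> hall_relation I (M - {e})"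
proof -
  define \<E> where "\<E> = {E. E \<subseteq> D \<and> hall_relation I (D - E)}"
  have "\<exists>E\<in>\<E>. \<forall>V\<in>\<E>. E \<subseteq> V \<longrightarrow> V = E"
  proof (rule subset_Zorn')
    fix \<C> assume chain: "subset.chain \<E> \<C>"
    then have sub: "\<C> \<subseteq> \<E>" by (simp add: subset_chain_def)
    have "hall_relation I (D - \<Union>\<C>)"
    proof (cases "\<C> = {}")
      case True then show ?thesis using D by simp
    next
      case False
      show ?thesis unfolding hall_relation_def
      proof (intro allI impI)
        fix J assume J: "finite J" "J \<subseteq> I"
        let ?S = "D \<inter> (J \<times> UNIV)"
        have "?S \<subseteq> Sigma J (\<lambda>i. D `` {i})" by auto
        moreover have "finite (Sigma J (\<lambda>i. D `` {i}))" using J fin by auto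
        ultimately have "finite (?S \<inter> \<Union>\<C>)" by (meson finite_Int finite_subset)
        then obtain E where E: "E \<in> \<C>" "?S \<inter> \<Union>\<C> \<subseteq> E"
          using finite_subset_Union_chain[OF _ _ False chain] by blast
        have "(D - \<Union>\<C>) `` J = (D - E) `` J" using E by blast
        then show "card J \<le> card ((D - \<Union>\<C>) `` J)"
          using sub E J by (auto simp: \<E>_def hall_relation_def)
      qed
    qed
    then show "\<Union>\<C> \<in> \<E>" using sub by (auto simp: \<E>_def)
  qed
  then obtain E where E_in: "E \<in> \<E>" and E_max: "\<forall>V\<in>\<E>. E \<subseteq> V \<longrightarrow> V = E" by blast
  have E: "E \<subseteq> D" "hall_relation I (D - E)" using E_in by (simp_all add: \<E>_def)
  have max: "E' = E" if "E' \<subseteq> D" "hall_relation I (D - E')" "E \<subseteq> E'" for E'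
    using E_max that by (simp add: \<E>_def)
  show thesis
  proof (rule that[of "D - E"])
    fix e assume e: "e \<in> D - E"
    then have "D - E - {e} = D - insert e E" by blast
    then show "\<not> hall_relation I (D - E - {e})" using max[of "insert e E"] e E by auto
  qed (use E in auto)
qed

text \<open>
Rado's proof of Hall's theorem for infinitely many finite sets: a minimal relation satisfying
Hall's condition is a function. If an index were related to two values \<open>x\<close> and \<open>y\<close>, removing either
of the two pairs would break the condition at finite index sets \<open>P\<close> and \<open>Q\<close>; counting the values
of \<open>P \<union> Q\<close> and \<open>P \<inter> Q\<close> then contradicts Hall's condition.
\<close>

theorem infinite_hall:
  assumes hall: "hall_relation I D" and fin: "\<And>i. i \<in> I \<Longrightarrow> finite (D `` {i})"
  obtains f where "inj_on f I" "\<And>i. i \<in> I \<Longrightarrow> (i, f i) \<in> D"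
proof -
  obtain M where M: "M \<subseteq> D" "hall_relation I M"
    and min: "\<And>e. e \<in> M \<Longrightarrow> \<not> hall_relation I (M - {e})"
    using hall_relation_minimal[OF assms] by blast
  have finM: "finite (M `` J)" if "finite J" "J \<subseteq> I" for J
  proof -
    have "M `` J \<subseteq> (\<Union>i\<in>J. D `` {i})" using M(1) by blast
    moreover have "finite (\<Union>i\<in>J. D `` {i})" using that fin by blast
    ultimately show ?thesis by (rule finite_subset)
  qed
  have hallM: "card J \<le> card (M `` J)" if "finite J" "J \<subseteq> I" for J
    using M(2) that by (simp add: hall_relation_def)
  have violated: "\<exists>P. finite P \<and> P \<subseteq> I \<and> i \<notin> P \<and> card (M `` P \<union> (M `` {i} - {x})) \<le> card P"
    if ix: "(i, x) \<in> M" for i x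
  proof -
    obtain J where J: "finite J" "J \<subseteq> I" "card ((M - {(i, x)}) `` J) < card J"
      using min[OF ix] by (auto simp: hall_relation_def not_le)
    have "i \<in> J"
    proof (rule ccontr)
      assume "i \<notin> J"
      then have "(M - {(i, x)}) `` J = M `` J" by blast
      then show False using J hallM[of J] by simp
    qed
    moreover from this have "(M - {(i, x)}) `` J = M `` (J - {i}) \<union> (M `` {i} - {x})" by blast
    ultimately show ?thesis using J by (intro exI[of _ "J - {i}"]) (auto simp: card_Diff_singleton)
  qed
  have uniq: "x = y" if i: "i \<in> I" and x: "(i, x) \<in> M" and y: "(i, y) \<in> M" for i x y
  proof (rule ccontr)
    assume ne: "x \<noteq> y"
    obtain P where P: "finite P" "P \<subseteq> I" "i \<notin> P" "card (M `` P \<union> (M `` {i} - {x})) \<le> card P"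
      using violated[OF x] by blast
    obtain Q where Q: "finite Q" "Q \<subseteq> I" "i \<notin> Q" "card (M `` Q \<union> (M `` {i} - {y})) \<le> card Q"
      using violated[OF y] by blast
    let ?A = "M `` P \<union> (M `` {i} - {x})" and ?B = "M `` Q \<union> (M `` {i} - {y})"
    have finAB: "finite ?A" "finite ?B" using finM P Q i by auto
    have "?A \<union> ?B = M `` insert i (P \<union> Q)" using ne by blast
    then have 1: "Suc (card (P \<union> Q)) \<le> card (?A \<union> ?B)"
      using hallM[of "insert i (P \<union> Q)"] P Q i by simp
    have "M `` (P \<inter> Q) \<subseteq> ?A \<inter> ?B" by blast
    then have 2: "card (P \<inter> Q) \<le> card (?A \<inter> ?B)"
      using hallM[of "P \<inter> Q"] P card_mono[of "?A \<inter> ?B" "M `` (P \<inter> Q)"] finAB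
      by (meson finite_Int inf.coboundedI1 le_trans)
    show False
      using 1 2 card_Un_Int[OF finAB] card_Un_Int[OF P(1) Q(1)] P(4) Q(4) by linarith
  qed
  have "\<exists>x. (i, x) \<in> M" if "i \<in> I" for i
    using hallM[of "{i}"] that by (cases "M `` {i} = {}") auto
  then obtain f where f: "\<And>i. i \<in> I \<Longrightarrow> (i, f i) \<in> M" by metis
  have "inj_on f I"
  proof (rule inj_onI, rule ccontr)
    fix i j assume ij: "i \<in> I" "j \<in> I" "f i = f j" "i \<noteq> j"
    have "M `` {i, j} \<subseteq> {f i}" using uniq[OF _ f] ij by auto
    then have "card (M `` {i, j}) \<le> 1" using card_mono[of "{f i}"] by simp
    then show False using hallM[of "{i, j}"] ij by simp
  qed
  then show thesis using that[of f] f M(1) by blast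
qed

section \<open>Amenable subsets\<close>

text \<open>
A finitely additive, left invariant set function on a group with values in \<open>[0, \<infinity>]\<close>. The value at
the empty set may be infinite; it is \<open>0\<close> as soon as some set has finite measure.
\<close>

definition invariant_measure :: "('g, 'h) monoid_scheme \<Rightarrow> ('g set \<Rightarrow> ennreal) \<Rightarrow> bool"
  where "invariant_measure G \<mu> \<longleftrightarrow>
    (\<forall>A B. A \<subseteq> carrier G \<longrightarrow> B \<subseteq> carrier G \<longrightarrow> A \<inter> B = {} \<longrightarrow> \<mu> (A \<union> B) = \<mu> A + \<mu> B) \<and>
    (\<forall>A g. A \<subseteq> carrier G \<longrightarrow> g \<in> carrier G \<longrightarrow> \<mu> (g <#\<^bsub>G\<^esub> A) = \<mu> A)"

lemma amenable_subset_iff: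
  "amenable_subset G Y \<longleftrightarrow> (\<exists>\<mu>. invariant_measure G \<mu> \<and> \<mu> Y = 1)"
  by (simp add: amenable_subset_def invariant_measure_def conj_assoc)

text \<open>
An injection that moves each point by a left translation from a fixed finite set preserves the
measure.
\<close>

lemma invariant_measure_piecewise_translation:
  assumes "group G" and \<mu>: "invariant_measure G \<mu>" and empty: "\<mu> {} = 0"
    and L: "finite L" "L \<subseteq> carrier G" and V: "V \<subseteq> carrier G"
    and l: "\<And>x. x \<in> V \<Longrightarrow> l x \<in> L" and inj: "inj_on (\<lambda>x. l x \<otimes>\<^bsub>G\<^esub> x) V"
  shows "\<mu> ((\<lambda>x. l x \<otimes>\<^bsub>G\<^esub> x) ` V) = \<mu> V"
proof -
  interpret group G by fact
  let ?f = "\<lambda>x. l x \<otimes>\<^bsub>G\<^esub> x"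
  have add: "\<mu> (A \<union> B) = \<mu> A + \<mu> B" if "A \<subseteq> carrier G" "B \<subseteq> carrier G" "A \<inter> B = {}" for A B
    using \<mu> that by (simp add: invariant_measure_def)
  have fX: "?f ` Y \<subseteq> carrier G" if "Y \<subseteq> V" for Y using l L V that by blast
  have "\<mu> (?f ` {x \<in> V. l x \<in> K}) = \<mu> {x \<in> V. l x \<in> K}" if "finite K" "K \<subseteq> L" for K
    using that
  proof (induction K)
    case empty then show ?case by simp
  next
    case (insert k K)
    let ?Y = "{x \<in> V. l x = k}" and ?Z = "{x \<in> V. l x \<in> K}"
    have split: "{x \<in> V. l x \<in> insert k K} = ?Y \<union> ?Z" by blast
    have disj: "?Y \<inter> ?Z = {}" using insert.hyps by blast
    have "?f ` ?Y \<inter> ?f ` ?Z = ?f ` (?Y \<inter> ?Z)"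
      using inj by (intro inj_on_image_Int[symmetric]) (auto simp: inj_on_def)
    then have disj': "?f ` ?Y \<inter> ?f ` ?Z = {}" using disj by simp
    have "?f ` ?Y = k <#\<^bsub>G\<^esub> ?Y" by (auto simp: l_coset_def)
    moreover have "?Y \<subseteq> carrier G" "k \<in> carrier G" using insert.prems L V by auto
    ultimately have "\<mu> (?f ` ?Y) = \<mu> ?Y"
      using \<mu> unfolding invariant_measure_def by presburger
    moreover have "\<mu> (?f ` (?Y \<union> ?Z)) = \<mu> (?f ` ?Y) + \<mu> (?f ` ?Z)"
      unfolding image_Un using disj' by (intro add fX) auto
    moreover have "\<mu> (?Y \<union> ?Z) = \<mu> ?Y + \<mu> ?Z"
      using disj V by (intro add) auto
    ultimately show ?case using insert.IH insert.prems by (simp only: split insert_subset)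
  qed
  from this[of L] L have "\<mu> (?f ` {x \<in> V. l x \<in> L}) = \<mu> {x \<in> V. l x \<in> L}" by simp
  moreover have "{x \<in> V. l x \<in> L} = V" using l by blast
  ultimately show ?thesis by simp
qed

text \<open>
Hall's theorem for two copies of \<open>V\<close> turns the doubling condition into two injections of \<open>V\<close> into
itself with disjoint images, both moving points by elements of \<open>L\<close>. This is a paradoxical
decomposition of \<open>V\<close>, which no invariant measure with value \<open>1\<close> at \<open>V\<close> allows.
\<close>

lemma doubling_not_amenable:
  assumes "group G" and V: "V \<subseteq> carrier G" and L: "finite L" "L \<subseteq> carrier G"
    and doubling: "\<And>Y. finite Y \<Longrightarrow> Y \<subseteq> V \<Longrightarrow> 2 * card Y \<le> card ((L <#>\<^bsub>G\<^esub> Y) \<inter> V)"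
  shows "\<not> amenable_subset G V"
proof
  interpret group G by fact
  assume "amenable_subset G V"
  then obtain \<mu> where \<mu>: "invariant_measure G \<mu>" and \<mu>V: "\<mu> V = 1"
    by (auto simp: amenable_subset_iff)
  have add: "\<mu> (A \<union> B) = \<mu> A + \<mu> B" if "A \<subseteq> carrier G" "B \<subseteq> carrier G" "A \<inter> B = {}" for A B
    using \<mu> that by (simp add: invariant_measure_def)
  have empty: "\<mu> {} = 0" 
  proof -
    have "1 + \<mu> {} = 1 + 0" using add[of V "{}"] V \<mu>V by simp
    then show ?thesis unfolding ennreal_add_left_cancel by simp
  qed
  let ?I = "V \<times> (UNIV :: bool set)"
  define D where "D = {((x, b :: bool), y) | x b y. y \<in> (L <#>\<^bsub>G\<^esub> {x}) \<inter> V}"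
  have finL: "finite (L <#>\<^bsub>G\<^esub> Y)" if "finite Y" for Y
    using L that by (auto simp: D_def set_mult_def)
  have DJ: "D `` J = (L <#>\<^bsub>G\<^esub> (fst ` J)) \<inter> V" for J :: "('a \<times> bool) set"
    by (force simp: D_def set_mult_def)
  have hall: "hall_relation ?I D" unfolding hall_relation_def
  proof (intro allI impI)
    fix J assume J: "finite J" "J \<subseteq> ?I"
    have "J \<subseteq> fst ` J \<times> (UNIV :: bool set)" by force
    then have "card J \<le> card (fst ` J \<times> (UNIV :: bool set))"
      using J by (intro card_mono) auto
    also have "\<dots> = 2 * card (fst ` J)" by (simp add: card_cartesian_product)
    also have "\<dots> \<le> card (D `` J)" unfolding DJ using J by (intro doubling) auto
    finally show "card J \<le> card (D `` J)" .
  qed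
  have fin: "finite (D `` {i})" for i unfolding DJ using finL by auto
  obtain f where f: "inj_on f ?I" "\<And>i. i \<in> ?I \<Longrightarrow> (i, f i) \<in> D"
    using infinite_hall[OF hall fin] by blast
  have "\<exists>l. \<forall>x\<in>V. l x \<in> L \<and> f (x, b) = l x \<otimes>\<^bsub>G\<^esub> x" for b
  proof -
    have "\<exists>k. k \<in> L \<and> f (x, b) = k \<otimes>\<^bsub>G\<^esub> x" if "x \<in> V" for x
      using f(2)[of "(x, b)"] that by (auto simp: D_def set_mult_def)
    then show ?thesis by metis
  qed
  then obtain l where l: "\<And>b x. x \<in> V \<Longrightarrow> l b x \<in> L" "\<And>b x. x \<in> V \<Longrightarrow> f (x, b) = l b x \<otimes>\<^bsub>G\<^esub> x"
    by metis
  let ?h = "\<lambda>b. (\<lambda>x. l b x \<otimes>\<^bsub>G\<^esub> x) ` V"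
  have img: "?h b = f ` (V \<times> {b})" for b
  proof -
    have "?h b = (\<lambda>x. f (x, b)) ` V" using l(2) by (intro image_cong) simp_all
    also have "\<dots> = f ` (V \<times> {b})" by (auto simp: image_iff)
    finally show ?thesis .
  qed
  have one: "\<mu> (?h b) = 1" for b
  proof -
    have "inj_on (\<lambda>x. l b x \<otimes>\<^bsub>G\<^esub> x) V"
    proof (rule inj_onI)
      fix x y assume "x \<in> V" "y \<in> V" "l b x \<otimes>\<^bsub>G\<^esub> x = l b y \<otimes>\<^bsub>G\<^esub> y"
      then show "x = y" using inj_onD[OF f(1), of "(x, b)" "(y, b)"] l(2)[of x b] l(2)[of y b] by auto
    qed
    then show ?thesis
      using invariant_measure_piecewise_translation[OF assms(1) \<mu> empty L V, of "l b"] l(1) \<mu>V by simp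
  qed
  have disj: "?h True \<inter> ?h False = {}"
    unfolding img using f(1) by (auto simp: inj_on_def)
  have sub: "?h b \<subseteq> V" for b unfolding img using f(2) by (auto simp: D_def)
  \<comment> \<open>The two images need not cover \<open>V\<close>, so the rest of \<open>V\<close> enters as well.\<close>
  define U where "U = ?h True \<union> ?h False"
  have "\<mu> U = 1 + 1"
    unfolding U_def using add[OF _ _ disj] subset_trans[OF sub V] by (simp only: one)
  moreover have "\<mu> (U \<union> (V - U)) = \<mu> U + \<mu> (V - U)"
    using subset_trans[OF sub V] V by (intro add) (auto simp: U_def)
  moreover have "U \<union> (V - U) = V" using sub by (auto simp: U_def)
  ultimately have "1 + 1 \<le> (1::ennreal)" using \<mu>V by (metis le_iff_add)
  then show False by simp
qed


section \<open>Finite sums\<close>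

context abelian_monoid
begin

lemma finsum_Times:
  assumes "finite I" "finite J" and f: "\<And>i j. i \<in> I \<Longrightarrow> j \<in> J \<Longrightarrow> f i j \<in> carrier G"
  shows "(\<Oplus>p\<in>I \<times> J. f (fst p) (snd p)) = (\<Oplus>i\<in>I. \<Oplus>j\<in>J. f i j)"
  using assms(1) f
proof (induction I)
  case empty then show ?case by simp
next
  case (insert i I)
  have eq: "insert i I \<times> J = Pair i ` J \<union> I \<times> J" by auto
  have "(\<Oplus>p\<in>insert i I \<times> J. f (fst p) (snd p))
      = (\<Oplus>p\<in>Pair i ` J. f (fst p) (snd p)) \<oplus> (\<Oplus>p\<in>I \<times> J. f (fst p) (snd p))"
    unfolding eq using insert assms(2) by (intro finsum_Un_disjoint) auto
  also have "(\<Oplus>p\<in>Pair i ` J. f (fst p) (snd p)) = (\<Oplus>j\<in>J. f i j)"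
    using insert.prems by (subst finsum_reindex) (auto simp: inj_on_def)
  also have "(\<Oplus>p\<in>I \<times> J. f (fst p) (snd p)) = (\<Oplus>i\<in>I. \<Oplus>j\<in>J. f i j)"
    using insert.prems by (intro insert.IH) auto
  finally show ?case using insert by (simp add: Pi_iff)
qed

lemma finsum_swap:
  assumes "finite I" "finite J" and f: "\<And>i j. i \<in> I \<Longrightarrow> j \<in> J \<Longrightarrow> f i j \<in> carrier G"
  shows "(\<Oplus>i\<in>I. \<Oplus>j\<in>J. f i j) = (\<Oplus>j\<in>J. \<Oplus>i\<in>I. f i j)"
proof -
  have eq: "I \<times> J = prod.swap ` (J \<times> I)" by auto
  have "(\<Oplus>i\<in>I. \<Oplus>j\<in>J. f i j) = (\<Oplus>p\<in>I \<times> J. f (fst p) (snd p))"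
    using finsum_Times[of I J f] assms by simp
  also have "\<dots> = (\<Oplus>p\<in>J \<times> I. f (snd p) (fst p))"
    unfolding eq using f by (subst finsum_reindex) (auto simp: inj_on_def)
  also have "\<dots> = (\<Oplus>j\<in>J. \<Oplus>i\<in>I. f i j)"
    using finsum_Times[of J I "\<lambda>j i. f i j"] assms by simp
  finally show ?thesis .
qed

lemma finsum_delta:
  assumes "finite I" "k \<in> I" "a \<in> carrier G"
  shows "(\<Oplus>i\<in>I. if i = k then a else \<zero>) = a"
proof -
  have "(\<Oplus>i\<in>I. if i = k then a else \<zero>) = (\<Oplus>i\<in>I. if k = i then a else \<zero>)"
    using assms by (intro finsum_cong') auto
  then show ?thesis using finsum_singleton[OF assms(2,1), of "\<lambda>_. a"] assms(3) by simp
qed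

end

text \<open>
The next two lemmas are about additive maps of a ring into itself that need not be ring
homomorphisms, such as the coordinate functions introduced below.
\<close>

lemma (in ring) additive_zero:
  assumes h: "h \<in> carrier R \<rightarrow> carrier R"
    and add: "\<And>x y. x \<in> carrier R \<Longrightarrow> y \<in> carrier R \<Longrightarrow> h (x \<oplus> y) = h x \<oplus> h y"
  shows "h \<zero> = \<zero>"
proof -
  have "h \<zero> \<in> carrier R" using h by auto
  moreover have "h \<zero> \<oplus> h \<zero> = h \<zero>" using add[of \<zero> \<zero>] by simp
  ultimately show ?thesis by simp
qed

lemma (in ring) additive_finsum:
  assumes h: "h \<in> carrier R \<rightarrow> carrier R"
    and add: "\<And>x y. x \<in> carrier R \<Longrightarrow> y \<in> carrier R \<Longrightarrow> h (x \<oplus> y) = h x \<oplus> h y"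
    and f: "f \<in> I \<rightarrow> carrier R"
  shows "h (\<Oplus>i\<in>I. f i) = (\<Oplus>i\<in>I. h (f i))"
  using f
proof (induction I rule: infinite_finite_induct)
  case (infinite I)
  then show ?case by (simp add: finsum_infinite additive_zero[OF h add])
next
  case empty
  show ?case by (simp add: additive_zero[OF h add])
next
  case (insert i I)
  then have "f i \<in> carrier R" "f \<in> I \<rightarrow> carrier R" by auto
  moreover have "(\<lambda>i. h (f i)) \<in> I \<rightarrow> carrier R" "h (f i) \<in> carrier R"
    using h insert.prems by auto
  ultimately show ?case using insert add by simp
qed

lemma (in ring) finsum_subring:
  assumes S: "ring (R\<lparr>carrier := B\<rparr>)" and "B \<subseteq> carrier R" "f \<in> I \<rightarrow> B"
  shows "finsum (R\<lparr>carrier := B\<rparr>) f I = finsum R f I"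
  using assms(3)
proof (induction I rule: infinite_finite_induct)
  case (infinite I)
  interpret S: ring "R\<lparr>carrier := B\<rparr>" by fact
  show ?case using infinite(1) S.finsum_infinite[of I f] by (simp add: finsum_infinite)
next
  case empty
  interpret S: ring "R\<lparr>carrier := B\<rparr>" by fact
  show ?case using S.finsum_empty[of f] by simp
next
  case (insert i I)
  interpret S: ring "R\<lparr>carrier := B\<rparr>" by fact
  have "f i \<in> B" "f \<in> I \<rightarrow> B" using insert.prems by auto
  moreover from this have "f i \<in> carrier R" "f \<in> I \<rightarrow> carrier R" using assms(2) by auto
  ultimately show ?case using insert S.finsum_insert[OF insert.hyps, of f] by simp
qed

section \<open>Matrix form of the unbounded generating number\<close>

text \<open>
The identity matrix with index set \<open>I\<close> is a product \<open>F H\<close> of an \<open>I \<times> J\<close> matrix and a \<open>J \<times> I\<close>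
matrix over \<open>R\<close>. For finite \<open>I\<close> and \<open>J\<close> this says that the free right module on \<open>J\<close> maps onto the
free right module on \<open>I\<close>. Arbitrary index sets are allowed in order to use pairs as indices.
\<close>

definition identity_factors :: "('r, 'k) ring_scheme \<Rightarrow> 'i set \<Rightarrow> 'j set \<Rightarrow> bool"
  where "identity_factors R I J \<longleftrightarrow>
    (\<exists>F H. (\<forall>i\<in>I. \<forall>j\<in>J. F i j \<in> carrier R \<and> H j i \<in> carrier R) \<and>
      (\<forall>i\<in>I. \<forall>k\<in>I. (\<Oplus>\<^bsub>R\<^esub>j\<in>J. F i j \<otimes>\<^bsub>R\<^esub> H j k) = (if i = k then \<one>\<^bsub>R\<^esub> else \<zero>\<^bsub>R\<^esub>)))"

lemma identity_factorsE:
  assumes "identity_factors R I J"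
  obtains F H where "\<And>i j. i \<in> I \<Longrightarrow> j \<in> J \<Longrightarrow> F i j \<in> carrier R"
    and "\<And>i j. i \<in> I \<Longrightarrow> j \<in> J \<Longrightarrow> H j i \<in> carrier R"
    and "\<And>i k. i \<in> I \<Longrightarrow> k \<in> I \<Longrightarrow>
      (\<Oplus>\<^bsub>R\<^esub>j\<in>J. F i j \<otimes>\<^bsub>R\<^esub> H j k) = (if i = k then \<one>\<^bsub>R\<^esub> else \<zero>\<^bsub>R\<^esub>)"
proof -
  from assms obtain F H where
    "(\<forall>i\<in>I. \<forall>j\<in>J. F i j \<in> carrier R \<and> H j i \<in> carrier R) \<and>
      (\<forall>i\<in>I. \<forall>k\<in>I. (\<Oplus>\<^bsub>R\<^esub>j\<in>J. F i j \<otimes>\<^bsub>R\<^esub> H j k) = (if i = k then \<one>\<^bsub>R\<^esub> else \<zero>\<^bsub>R\<^esub>))"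
    unfolding identity_factors_def by (elim exE)
  then show thesis by (intro that[of F H]) simp_all
qed

lemma right_power_simps:
  "carrier (right_power R n) = {..<n} \<rightarrow>\<^sub>E carrier R"
  "x \<oplus>\<^bsub>right_power R n\<^esub> y = (\<lambda>i\<in>{..<n}. x i \<oplus>\<^bsub>R\<^esub> y i)"
  "a \<odot>\<^bsub>right_power R n\<^esub> x = (\<lambda>i\<in>{..<n}. x i \<otimes>\<^bsub>R\<^esub> a)"
  by (simp_all add: right_power_def)

context ring
begin

lemma epi_of_identity_factors:
  assumes "identity_factors R {..<m} {..<n}"
  shows "module_epis R (right_power R n) (right_power R m) \<noteq> {}"
proof -
  obtain F H where "\<And>i j. i \<in> {..<m} \<Longrightarrow> j \<in> {..<n} \<Longrightarrow> F i j \<in> carrier R"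
    and "\<And>i j. i \<in> {..<m} \<Longrightarrow> j \<in> {..<n} \<Longrightarrow> H j i \<in> carrier R"
    and "\<And>i k. i \<in> {..<m} \<Longrightarrow> k \<in> {..<m} \<Longrightarrow>
      (\<Oplus>j\<in>{..<n}. F i j \<otimes> H j k) = (if i = k then \<one> else \<zero>)"
    using assms by (rule identity_factorsE) blast
  then have F: "\<And>i j. i < m \<Longrightarrow> j < n \<Longrightarrow> F i j \<in> carrier R"
    and H: "\<And>i j. i < m \<Longrightarrow> j < n \<Longrightarrow> H j i \<in> carrier R"
    and FH: "\<And>i k. i < m \<Longrightarrow> k < m \<Longrightarrow>
      (\<Oplus>j\<in>{..<n}. F i j \<otimes> H j k) = (if i = k then \<one> else \<zero>)"
    by simp_all
  define f where "f x = (\<lambda>i\<in>{..<m}. \<Oplus>j\<in>{..<n}. F i j \<otimes> x j)" for x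
  have comp: "x j \<in> carrier R" if "x \<in> {..<n} \<rightarrow>\<^sub>E carrier R" "j < n" for x :: "nat \<Rightarrow> 'a" and j n
    using that by auto
  have f_in: "f x \<in> {..<m} \<rightarrow>\<^sub>E carrier R" if x: "x \<in> {..<n} \<rightarrow>\<^sub>E carrier R" for x
    using F comp[OF x] by (auto simp: f_def)
  have "f \<in> linear_maps R (right_power R n) (right_power R m)"
    unfolding linear_maps_def right_power_simps
  proof (intro CollectI conjI ballI funcsetI)
    fix x y assume x: "x \<in> {..<n} \<rightarrow>\<^sub>E carrier R" and y: "y \<in> {..<n} \<rightarrow>\<^sub>E carrier R"
    show "f (\<lambda>i\<in>{..<n}. x i \<oplus> y i) = (\<lambda>i\<in>{..<m}. f x i \<oplus> f y i)"
      unfolding f_def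
    proof (rule restrict_ext)
      fix i assume i: "i \<in> {..<m}"
      have "(\<Oplus>j\<in>{..<n}. F i j \<otimes> (\<lambda>i\<in>{..<n}. x i \<oplus> y i) j)
          = (\<Oplus>j\<in>{..<n}. F i j \<otimes> x j \<oplus> F i j \<otimes> y j)"
        using i F comp[OF x] comp[OF y] by (intro finsum_cong') (auto simp: r_distr)
      also have "\<dots> = (\<Oplus>j\<in>{..<n}. F i j \<otimes> x j) \<oplus> (\<Oplus>j\<in>{..<n}. F i j \<otimes> y j)"
        using i F comp[OF x] comp[OF y] by (intro finsum_addf) auto
      finally show "(\<Oplus>j\<in>{..<n}. F i j \<otimes> (\<lambda>i\<in>{..<n}. x i \<oplus> y i) j)
        = (\<lambda>i\<in>{..<m}. \<Oplus>j\<in>{..<n}. F i j \<otimes> x j) i \<oplus> (\<lambda>i\<in>{..<m}. \<Oplus>j\<in>{..<n}. F i j \<otimes> y j) i"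
        using i by simp
    qed
  next
    fix a x assume a: "a \<in> carrier R" and x: "x \<in> {..<n} \<rightarrow>\<^sub>E carrier R"
    show "f (\<lambda>i\<in>{..<n}. x i \<otimes> a) = (\<lambda>i\<in>{..<m}. f x i \<otimes> a)"
      unfolding f_def
    proof (rule restrict_ext)
      fix i assume i: "i \<in> {..<m}"
      have "(\<Oplus>j\<in>{..<n}. F i j \<otimes> (\<lambda>i\<in>{..<n}. x i \<otimes> a) j) = (\<Oplus>j\<in>{..<n}. (F i j \<otimes> x j) \<otimes> a)"
        using a i F comp[OF x] by (intro finsum_cong') (auto simp: m_assoc)
      also have "\<dots> = (\<Oplus>j\<in>{..<n}. F i j \<otimes> x j) \<otimes> a"
        using a i F comp[OF x] by (intro finsum_ldistr[symmetric]) auto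
      finally show "(\<Oplus>j\<in>{..<n}. F i j \<otimes> (\<lambda>i\<in>{..<n}. x i \<otimes> a) j)
        = (\<lambda>i\<in>{..<m}. \<Oplus>j\<in>{..<n}. F i j \<otimes> x j) i \<otimes> a"
        using i by simp
    qed
  qed (use f_in in auto)
  moreover have "f ` ({..<n} \<rightarrow>\<^sub>E carrier R) = {..<m} \<rightarrow>\<^sub>E carrier R"
  proof (intro equalityI subsetI)
    fix y assume y: "y \<in> {..<m} \<rightarrow>\<^sub>E carrier R"
    \<comment> \<open>Multiplication by \<open>H\<close> gives a preimage.\<close>
    let ?x = "\<lambda>j\<in>{..<n}. \<Oplus>k\<in>{..<m}. H j k \<otimes> y k"
    have x_in: "?x \<in> {..<n} \<rightarrow>\<^sub>E carrier R" using H comp[OF y] by auto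
    have "f ?x i = y i" if i: "i < m" for i
    proof -
      have "f ?x i = (\<Oplus>j\<in>{..<n}. F i j \<otimes> (\<Oplus>k\<in>{..<m}. H j k \<otimes> y k))"
        unfolding f_def using i F H comp[OF y]
        by (simp, intro finsum_cong') auto
      also have "\<dots> = (\<Oplus>j\<in>{..<n}. \<Oplus>k\<in>{..<m}. F i j \<otimes> H j k \<otimes> y k)"
        using i F H comp[OF y]
        by (intro finsum_cong') (auto simp: finsum_rdistr m_assoc Pi_iff intro!: finsum_cong')
      also have "\<dots> = (\<Oplus>k\<in>{..<m}. \<Oplus>j\<in>{..<n}. F i j \<otimes> H j k \<otimes> y k)"
        using i F H comp[OF y] by (intro finsum_swap) auto
      also have "\<dots> = (\<Oplus>k\<in>{..<m}. (\<Oplus>j\<in>{..<n}. F i j \<otimes> H j k) \<otimes> y k)"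
        using i F H comp[OF y] by (intro finsum_cong') (auto intro!: finsum_ldistr[symmetric])
      also have "\<dots> = (\<Oplus>k\<in>{..<m}. if k = i then y i else \<zero>)"
        using i comp[OF y] by (intro finsum_cong') (auto simp: FH)
      also have "\<dots> = y i" using i comp[OF y] by (intro finsum_delta) auto
      finally show ?thesis .
    qed
    then have "f ?x = y" using f_in[OF x_in] y by (intro PiE_ext[of _ "{..<m}"]) auto
    then show "y \<in> f ` ({..<n} \<rightarrow>\<^sub>E carrier R)" using imageI[OF x_in, of f] by simp
  qed (use f_in in auto)
  ultimately show ?thesis unfolding module_epis_def right_power_simps by blast
qed

lemma linear_map_expansion:
  assumes f: "f \<in> linear_maps R (right_power R n) (right_power R m)"
    and x: "x \<in> {..<n} \<rightarrow>\<^sub>E carrier R" and i: "i < m"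
  shows "f x i = (\<Oplus>j\<in>{..<n}. f (\<lambda>k\<in>{..<n}. if k = j then \<one> else \<zero>) i \<otimes> x j)"
proof -
  define e where "e j = (\<lambda>k\<in>{..<n}. if k = j then \<one> else \<zero>)" for j
  define r where "r K = (\<lambda>k\<in>{..<n}. if k \<in> K then x k else \<zero>)" for K
  have f_in: "f y i \<in> carrier R" if "y \<in> {..<n} \<rightarrow>\<^sub>E carrier R" for y
  proof -
    have "f \<in> ({..<n} \<rightarrow>\<^sub>E carrier R) \<rightarrow> ({..<m} \<rightarrow>\<^sub>E carrier R)"
      using f by (simp add: linear_maps_def right_power_simps)
    then show ?thesis using that i by (auto dest: funcset_mem)
  qed
  have add: "f (\<lambda>k\<in>{..<n}. y k \<oplus> z k) i = f y i \<oplus> f z i"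
    if "y \<in> {..<n} \<rightarrow>\<^sub>E carrier R" "z \<in> {..<n} \<rightarrow>\<^sub>E carrier R" for y z
    using f i that by (simp add: linear_maps_def right_power_simps)
  have smult: "f (\<lambda>k\<in>{..<n}. y k \<otimes> a) i = f y i \<otimes> a"
    if "y \<in> {..<n} \<rightarrow>\<^sub>E carrier R" "a \<in> carrier R" for y a
    using f i that by (simp add: linear_maps_def right_power_simps)
  have e_in: "e j \<in> {..<n} \<rightarrow>\<^sub>E carrier R" for j by (simp add: e_def restrict_PiE_iff)
  have r_in: "r K \<in> {..<n} \<rightarrow>\<^sub>E carrier R" for K
    using PiE_mem[OF x] by (simp add: r_def restrict_PiE_iff)
  have "f (r K) i = (\<Oplus>j\<in>K. f (e j) i \<otimes> x j)" if "finite K" "K \<subseteq> {..<n}" for K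
    using that
  proof (induction K)
    case empty
    have z: "(\<lambda>k\<in>{..<n}. \<zero>) \<in> {..<n} \<rightarrow>\<^sub>E carrier R" by (simp add: restrict_PiE_iff)
    have "(\<lambda>k\<in>{..<n}. (\<lambda>k\<in>{..<n}. \<zero>) k \<otimes> \<zero>) = (\<lambda>k\<in>{..<n}. \<zero>)"
      by (intro restrict_ext) simp
    then have "f (\<lambda>k\<in>{..<n}. \<zero>) i = \<zero>" using smult[OF z, of \<zero>] f_in[OF z] by simp
    moreover have "r {} = (\<lambda>k\<in>{..<n}. \<zero>)"
      unfolding r_def by (intro restrict_ext) simp
    ultimately show ?case by (simp only: finsum_empty)
  next
    case (insert j K)
    have xj: "x j \<in> carrier R" using insert.prems PiE_mem[OF x] by simp
    let ?s = "\<lambda>k\<in>{..<n}. e j k \<otimes> x j"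
    have s_in: "?s \<in> {..<n} \<rightarrow>\<^sub>E carrier R"
      using xj by (simp add: e_def restrict_PiE_iff)
    have "r (insert j K) = (\<lambda>k\<in>{..<n}. ?s k \<oplus> r K k)"
      using insert.hyps PiE_mem[OF x] xj unfolding r_def e_def by (intro restrict_ext) auto
    then have "f (r (insert j K)) i = f (e j) i \<otimes> x j \<oplus> f (r K) i"
      using add[OF s_in r_in] smult[OF e_in xj] by simp
    also have "f (r K) i = (\<Oplus>j\<in>K. f (e j) i \<otimes> x j)" using insert by simp
    also have "f (e j) i \<otimes> x j \<oplus> \<dots> = (\<Oplus>j\<in>insert j K. f (e j) i \<otimes> x j)"
      using insert PiE_mem[OF x] f_in[OF e_in] by (subst finsum_insert) auto
    finally show ?case .
  qed
  from this[of "{..<n}"] have "f (r {..<n}) i = (\<Oplus>j\<in>{..<n}. f (e j) i \<otimes> x j)" by simp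
  moreover have "r {..<n} = x" by (intro PiE_ext[OF r_in x]) (simp add: r_def)
  ultimately show ?thesis by (simp only: e_def)
qed

text \<open>
The columns of \<open>F\<close> are the images of the standard basis vectors under the epimorphism, and those of
\<open>H\<close> are preimages of standard basis vectors.
\<close>

lemma identity_factors_of_epi:
  assumes "module_epis R (right_power R n) (right_power R m) \<noteq> {}"
  shows "identity_factors R {..<m} {..<n}"
proof -
  obtain f where f: "f \<in> linear_maps R (right_power R n) (right_power R m)"
    and surj: "f ` ({..<n} \<rightarrow>\<^sub>E carrier R) = {..<m} \<rightarrow>\<^sub>E carrier R"
    using assms by (auto simp: module_epis_def right_power_simps)
  let ?e = "\<lambda>n j. \<lambda>k\<in>{..<n}. if k = j then \<one> else \<zero>"
  have e_in: "?e n j \<in> {..<n} \<rightarrow>\<^sub>E carrier R" for j and n :: nat by auto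
  have "\<exists>h. h \<in> {..<n} \<rightarrow>\<^sub>E carrier R \<and> f h = ?e m k" for k
  proof -
    have "?e m k \<in> f ` ({..<n} \<rightarrow>\<^sub>E carrier R)" unfolding surj by (rule e_in[of k m])
    then obtain h where "?e m k = f h" "h \<in> {..<n} \<rightarrow>\<^sub>E carrier R" by (rule imageE)
    then show ?thesis by (intro exI[of _ h]) simp
  qed
  then have "\<exists>h. \<forall>k. h k \<in> {..<n} \<rightarrow>\<^sub>E carrier R \<and> f (h k) = ?e m k"
    by (intro choice allI)
  then obtain h where h: "\<And>k. h k \<in> {..<n} \<rightarrow>\<^sub>E carrier R" "\<And>k. f (h k) = ?e m k" by blast
  show ?thesis unfolding identity_factors_def
  proof (rule exI[of _ "\<lambda>i j. f (?e n j) i"], rule exI[of _ "\<lambda>j k. h k j"], intro conjI ballI)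
    fix i j assume ij: "i \<in> {..<m}" "j \<in> {..<n}"
    have "f (?e n j) \<in> {..<m} \<rightarrow>\<^sub>E carrier R" using imageI[OF e_in[of j n], of f] unfolding surj .
    then show "f (?e n j) i \<in> carrier R" using ij by (rule_tac PiE_mem)
    show "h i j \<in> carrier R" using PiE_mem[OF h(1)] ij by simp
  next
    fix i k assume "i \<in> {..<m}" "k \<in> {..<m}"
    then show "(\<Oplus>j\<in>{..<n}. f (?e n j) i \<otimes> h k j) = (if i = k then \<one> else \<zero>)"
      using linear_map_expansion[OF f h(1), of i k, symmetric] h(2)[of k] by simp
  qed
qed

lemma UGN_iff_identity_factors:
  "UGN R \<longleftrightarrow> (\<forall>n>0. \<not> identity_factors R {..<Suc n} {..<n})"
proof -
  have "module_epis R (right_power R n) (right_power R (Suc n)) = {} \<longleftrightarrow>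
      \<not> identity_factors R {..<Suc n} {..<n}" for n
    using epi_of_identity_factors[of "Suc n" n] identity_factors_of_epi[of n "Suc n"] by argo
  then show ?thesis by (simp only: UGN_def)
qed

lemma UGN_nonzero:
  assumes "UGN R" shows "\<one> \<noteq> \<zero>"
proof
  assume "\<one> = \<zero>"
  then have "identity_factors R {..<Suc 1} {..<1::nat}"
    unfolding identity_factors_def by (intro exI[of _ "\<lambda>_ _. \<zero>"]) auto
  then show False using assms UGN_iff_identity_factors by (metis zero_less_one)
qed

text \<open>
The case of an empty \<open>J\<close> is separate, since the unbounded generating number only speaks of positive
exponents: then \<open>1 = 0\<close> in \<open>R\<close>, which is excluded because over the zero ring the map from the first
power to the second is onto.
\<close>

lemma identity_factors_card_le:
  assumes "UGN R" "finite I" "finite J" "identity_factors R I J"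
  shows "card I \<le> card J"
proof (rule ccontr)
  assume "\<not> card I \<le> card J"
  define n where "n = card J"
  have "Suc n \<le> card I" using \<open>\<not> card I \<le> card J\<close> by (simp add: n_def)
  then obtain K where K: "K \<subseteq> I" "card K = Suc n" "finite K"
    using obtain_subset_with_card_n by metis
  obtain a where a: "bij_betw a {..<Suc n} K"
    using ex_bij_betw_nat_finite[OF K(3)] K(2) by (auto simp: atLeast0LessThan)
  obtain b where b: "bij_betw b {..<n} J"
    using ex_bij_betw_nat_finite[OF assms(3)] by (auto simp: n_def atLeast0LessThan)
  obtain F H where F: "\<And>i j. i \<in> I \<Longrightarrow> j \<in> J \<Longrightarrow> F i j \<in> carrier R"
    and H: "\<And>i j. i \<in> I \<Longrightarrow> j \<in> J \<Longrightarrow> H j i \<in> carrier R"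
    and FH: "\<And>i k. i \<in> I \<Longrightarrow> k \<in> I \<Longrightarrow>
      (\<Oplus>j\<in>J. F i j \<otimes> H j k) = (if i = k then \<one> else \<zero>)"
    using assms(4) by (rule identity_factorsE) blast
  have a_in: "a i \<in> I" if "i < Suc n" for i using a K(1) that by (auto simp: bij_betw_def)
  have b_in: "b j \<in> J" if "j < n" for j using b that by (auto simp: bij_betw_def)
  have "identity_factors R {..<Suc n} {..<n}" unfolding identity_factors_def
  proof (rule exI[of _ "\<lambda>i j. F (a i) (b j)"], rule exI[of _ "\<lambda>j i. H (b j) (a i)"], intro conjI ballI)
    fix i k assume ik: "i \<in> {..<Suc n}" "k \<in> {..<Suc n}"
    have inj: "inj_on b {..<n}" and img: "b ` {..<n} = J" using b by (simp_all add: bij_betw_def)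
    have "(\<Oplus>j\<in>{..<n}. F (a i) (b j) \<otimes> H (b j) (a k)) = (\<Oplus>j\<in>b ` {..<n}. F (a i) j \<otimes> H j (a k))"
      using inj F H a_in b_in ik by (subst finsum_reindex) auto
    also have "\<dots> = (if a i = a k then \<one> else \<zero>)"
      unfolding img using FH a_in ik by simp
    also have "(a i = a k) = (i = k)"
      using a ik by (auto simp: bij_betw_def inj_on_def)
    finally show "(\<Oplus>j\<in>{..<n}. F (a i) (b j) \<otimes> H (b j) (a k)) = (if i = k then \<one> else \<zero>)" .
  qed (use F H a_in b_in in auto)
  show False
  proof (cases "n = 0")
    case True
    then have "\<one> = \<zero>" using FH[of "a 0" "a 0"] a_in[of 0] assms(3) by (simp add: n_def)
    then show False using UGN_nonzero assms(1) by blast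
  next
    case False
    then show False
      using assms(1) UGN_iff_identity_factors \<open>identity_factors R {..<Suc n} {..<n}\<close> by blast
  qed
qed

end

section \<open>Homogeneous components\<close>

locale group_graded_ring = G: group G + R: ring R
  for G :: "('g, 'h) monoid_scheme" (structure) and R :: "('r, 'k) ring_scheme" (structure) +
  fixes A :: "'g \<Rightarrow> 'r set"
  assumes grading: "group_grading G R A"
begin

lemma component_subgroup: "g \<in> carrier G \<Longrightarrow> additive_subgroup (A g) R"
  using grading by (simp add: group_grading_def)

lemma component_closed: "g \<in> carrier G \<Longrightarrow> a \<in> A g \<Longrightarrow> a \<in> carrier R"
  by (rule additive_subgroup.a_Hcarr[OF component_subgroup])

lemma zero_in_component: "g \<in> carrier G \<Longrightarrow> \<zero>\<^bsub>R\<^esub> \<in> A g"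
  by (rule additive_subgroup.zero_closed[OF component_subgroup])

lemma component_add: "g \<in> carrier G \<Longrightarrow> a \<in> A g \<Longrightarrow> b \<in> A g \<Longrightarrow> a \<oplus>\<^bsub>R\<^esub> b \<in> A g"
  by (rule additive_subgroup.a_closed[OF component_subgroup])

lemma component_mult:
  "g \<in> carrier G \<Longrightarrow> h \<in> carrier G \<Longrightarrow> a \<in> A g \<Longrightarrow> b \<in> A h \<Longrightarrow> a \<otimes>\<^bsub>R\<^esub> b \<in> A (g \<otimes>\<^bsub>G\<^esub> h)"
  using grading by (simp add: group_grading_def)

text \<open>
The family of homogeneous components of \<open>x\<close>, as a function that is undefined outside the group.
\<close>

definition is_decomposition :: "'r \<Rightarrow> ('g \<Rightarrow> 'r) \<Rightarrow> bool"
  where "is_decomposition x f \<longleftrightarrow> f \<in> (\<Pi>\<^sub>E g\<in>carrier G. A g) \<and>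
       finite {g \<in> carrier G. f g \<noteq> \<zero>\<^bsub>R\<^esub>} \<and>
       x = (\<Oplus>\<^bsub>R\<^esub>g\<in>{g \<in> carrier G. f g \<noteq> \<zero>\<^bsub>R\<^esub>}. f g)"

text \<open>
The homogeneous component of \<open>x\<close> of degree \<open>g\<close> is \<open>part x g\<close>; the support of \<open>x\<close> is the set of
degrees in which it does not vanish.
\<close>

definition part :: "'r \<Rightarrow> 'g \<Rightarrow> 'r"
  where "part x = (THE f. is_decomposition x f)"

definition support :: "'r \<Rightarrow> 'g set"
  where "support x = {g \<in> carrier G. part x g \<noteq> \<zero>\<^bsub>R\<^esub>}"

lemma decomposition_unique: "x \<in> carrier R \<Longrightarrow> \<exists>!f. is_decomposition x f"
  using grading unfolding group_grading_def is_decomposition_def by blast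

lemma part_decomposition: "x \<in> carrier R \<Longrightarrow> is_decomposition x (part x)"
  unfolding part_def by (rule theI'[OF decomposition_unique])

lemma part_eqI: "x \<in> carrier R \<Longrightarrow> is_decomposition x f \<Longrightarrow> part x = f"
  using decomposition_unique part_decomposition by blast

lemma part_in: "x \<in> carrier R \<Longrightarrow> g \<in> carrier G \<Longrightarrow> part x g \<in> A g"
  using part_decomposition[of x] unfolding is_decomposition_def by (auto dest: PiE_mem)

lemma part_closed [simp]: "x \<in> carrier R \<Longrightarrow> g \<in> carrier G \<Longrightarrow> part x g \<in> carrier R"
  by (rule component_closed[OF _ part_in])

lemma finite_support: "x \<in> carrier R \<Longrightarrow> finite (support x)"
  using part_decomposition[of x] unfolding is_decomposition_def support_def by blast

lemma support_subset: "support x \<subseteq> carrier G"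
  by (auto simp: support_def)

lemma sum_parts:
  assumes "x \<in> carrier R" "finite Z" "Z \<subseteq> carrier G" "support x \<subseteq> Z"
  shows "(\<Oplus>\<^bsub>R\<^esub>g\<in>Z. part x g) = x"
proof -
  have "x = (\<Oplus>\<^bsub>R\<^esub>g\<in>support x. part x g)"
    using part_decomposition[OF assms(1)] unfolding is_decomposition_def support_def by blast
  also have "\<dots> = (\<Oplus>\<^bsub>R\<^esub>g\<in>Z. part x g)"
    using assms
    by (intro R.add.finprod_mono_neutral_cong_left) (auto simp: support_def subset_iff)
  finally show ?thesis by simp
qed

text \<open>
Homogeneous components can be read off from any finite sum of homogeneous elements of distinct
degrees; the computations of components that follow rest on this lemma.
\<close>

lemma part_finsum:
  assumes T: "finite T" "T \<subseteq> carrier G" and f: "\<And>g. g \<in> T \<Longrightarrow> f g \<in> A g"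
    and g: "g \<in> carrier G"
  shows "part (\<Oplus>\<^bsub>R\<^esub>g\<in>T. f g) g = (if g \<in> T then f g else \<zero>\<^bsub>R\<^esub>)"
proof -
  let ?x = "\<Oplus>\<^bsub>R\<^esub>g\<in>T. f g"
  define h where "h = (\<lambda>g\<in>carrier G. if g \<in> T then f g else \<zero>\<^bsub>R\<^esub>)"
  have f_cl: "f g \<in> carrier R" if "g \<in> T" for g
    using component_closed[OF _ f] T that by blast
  then have x: "?x \<in> carrier R" by (intro R.finsum_closed) simp
  have sub: "{g \<in> carrier G. h g \<noteq> \<zero>\<^bsub>R\<^esub>} \<subseteq> T" by (auto simp: h_def split: if_splits)
  have "(\<Oplus>\<^bsub>R\<^esub>g\<in>{g \<in> carrier G. h g \<noteq> \<zero>\<^bsub>R\<^esub>}. h g) = ?x"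
  proof (rule R.add.finprod_mono_neutral_cong_left[OF T(1) sub])
    show "f i = \<zero>\<^bsub>R\<^esub>" if "i \<in> T - {g \<in> carrier G. h g \<noteq> \<zero>\<^bsub>R\<^esub>}" for i
      using that T(2) by (auto simp: h_def)
    show "h i = f i" if "i \<in> {g \<in> carrier G. h g \<noteq> \<zero>\<^bsub>R\<^esub>}" for i
      using that by (auto simp: h_def split: if_splits)
    show "f \<in> T \<rightarrow> carrier R" using f_cl by simp
  qed
  moreover have "h \<in> (\<Pi>\<^sub>E g\<in>carrier G. A g)"
    using f zero_in_component by (simp add: h_def restrict_PiE_iff)
  ultimately have "is_decomposition ?x h"
    using finite_subset[OF sub T(1)] by (simp add: is_decomposition_def)
  then have "part ?x = h" by (rule part_eqI[OF x])
  then show ?thesis using g by (simp add: h_def)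
qed

lemma part_homogeneous:
  assumes "h \<in> carrier G" "b \<in> A h" "g \<in> carrier G"
  shows "part b g = (if g = h then b else \<zero>\<^bsub>R\<^esub>)"
proof -
  have "(\<Oplus>\<^bsub>R\<^esub>g\<in>{h}. b) = b" using component_closed[OF assms(1,2)] by simp
  then show ?thesis using part_finsum[of "{h}" "\<lambda>_. b" g] assms by simp
qed

lemma part_add:
  assumes "x \<in> carrier R" "y \<in> carrier R" "g \<in> carrier G"
  shows "part (x \<oplus>\<^bsub>R\<^esub> y) g = part x g \<oplus>\<^bsub>R\<^esub> part y g"
proof -
  let ?T = "support x \<union> support y \<union> {g}"
  have T: "finite ?T" "?T \<subseteq> carrier G"
    using assms finite_support support_subset by auto
  have "x \<oplus>\<^bsub>R\<^esub> y = (\<Oplus>\<^bsub>R\<^esub>g\<in>?T. part x g) \<oplus>\<^bsub>R\<^esub> (\<Oplus>\<^bsub>R\<^esub>g\<in>?T. part y g)"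
    using sum_parts[OF assms(1) T] sum_parts[OF assms(2) T] by (metis Un_upper1 Un_upper2 le_supI1)
  also have "\<dots> = (\<Oplus>\<^bsub>R\<^esub>g\<in>?T. part x g \<oplus>\<^bsub>R\<^esub> part y g)"
    using T assms by (intro R.finsum_addf[symmetric]) auto
  finally have eq: "x \<oplus>\<^bsub>R\<^esub> y = (\<Oplus>\<^bsub>R\<^esub>g\<in>?T. part x g \<oplus>\<^bsub>R\<^esub> part y g)" .
  show ?thesis unfolding eq
    by (subst part_finsum[OF T]) (use T(2) assms in \<open>auto intro!: component_add part_in\<close>)
qed

lemma part_mult_homogeneous:
  assumes a: "a \<in> carrier R" and b: "b \<in> A h" and h: "h \<in> carrier G" and g: "g \<in> carrier G"
  shows "part (a \<otimes>\<^bsub>R\<^esub> b) (g \<otimes>\<^bsub>G\<^esub> h) = part a g \<otimes>\<^bsub>R\<^esub> b"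
proof -
  \<comment> \<open>The degree \<open>g\<close> is adjoined so that its component occurs in the sum even if it is zero.\<close>
  define T where "T = insert g (support a)"
  have T: "finite T" "T \<subseteq> carrier G" "support a \<subseteq> T" "g \<in> T"
    using a g finite_support support_subset by (auto simp: T_def)
  let ?s = "\<lambda>k. k \<otimes>\<^bsub>G\<^esub> h"
  define f where "f k = part a (k \<otimes>\<^bsub>G\<^esub> inv\<^bsub>G\<^esub> h) \<otimes>\<^bsub>R\<^esub> b" for k
  have f_s: "f (?s k) = part a k \<otimes>\<^bsub>R\<^esub> b" if "k \<in> carrier G" for k
    using that h by (simp add: f_def G.m_assoc)
  have b_cl: "b \<in> carrier R" using component_closed b h by blast
  have f_in: "f k \<in> A k" if "k \<in> ?s ` T" for k
    using that T(2) h component_mult[OF _ h part_in[OF a] b] f_s by auto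
  have sT: "finite (?s ` T)" "?s ` T \<subseteq> carrier G" using T h by auto
  have inj: "inj_on ?s T"
    using T(2) h by (intro inj_onI) (metis G.right_cancel subset_iff)
  have "a \<otimes>\<^bsub>R\<^esub> b = (\<Oplus>\<^bsub>R\<^esub>k\<in>T. part a k) \<otimes>\<^bsub>R\<^esub> b" using sum_parts[OF a T(1-3)] by simp
  also have "\<dots> = (\<Oplus>\<^bsub>R\<^esub>k\<in>T. part a k \<otimes>\<^bsub>R\<^esub> b)"
    using T(1,2) a b_cl by (intro R.finsum_ldistr) auto
  also have "\<dots> = (\<Oplus>\<^bsub>R\<^esub>k\<in>T. f (?s k))"
    using T(2) a b_cl f_s by (intro R.finsum_cong') (auto simp: subset_iff)
  also have "\<dots> = (\<Oplus>\<^bsub>R\<^esub>k\<in>?s ` T. f k)"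
    using component_closed[OF _ f_in] sT(2) by (intro R.finsum_reindex[symmetric] inj) blast
  finally have eq: "a \<otimes>\<^bsub>R\<^esub> b = (\<Oplus>\<^bsub>R\<^esub>k\<in>?s ` T. f k)" .
  have "part (a \<otimes>\<^bsub>R\<^esub> b) (?s g) = f (?s g)"
    unfolding eq using part_finsum[OF sT f_in, of "?s g"] g h T(4) by simp
  then show ?thesis using f_s[OF g] by simp
qed

text \<open>
The component \<open>e\<close> of degree \<open>1\<close> of the unit is a left unit for homogeneous elements, hence for the
unit itself, and so \<open>e = e 1 = 1\<close>.
\<close>

lemma one_in_identity_component: "\<one>\<^bsub>R\<^esub> \<in> A \<one>\<^bsub>G\<^esub>"
proof -
  define e where "e = part \<one>\<^bsub>R\<^esub> \<one>\<^bsub>G\<^esub>"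
  have e: "e \<in> A \<one>\<^bsub>G\<^esub>" "e \<in> carrier R" by (simp_all add: e_def part_in)
  have hom: "e \<otimes>\<^bsub>R\<^esub> b = b" if "h \<in> carrier G" "b \<in> A h" for b h
    using part_mult_homogeneous[of "\<one>\<^bsub>R\<^esub>" b h "\<one>\<^bsub>G\<^esub>"] part_homogeneous[OF that, of h] that
      component_closed[OF that]
    by (simp add: e_def)
  have "\<one>\<^bsub>R\<^esub> = (\<Oplus>\<^bsub>R\<^esub>g\<in>support \<one>\<^bsub>R\<^esub>. part \<one>\<^bsub>R\<^esub> g)"
    using sum_parts[OF _ finite_support support_subset, of "\<one>\<^bsub>R\<^esub>" "\<one>\<^bsub>R\<^esub>"] by simp
  also have "\<dots> = (\<Oplus>\<^bsub>R\<^esub>g\<in>support \<one>\<^bsub>R\<^esub>. e \<otimes>\<^bsub>R\<^esub> part \<one>\<^bsub>R\<^esub> g)"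
    using support_subset[of "\<one>\<^bsub>R\<^esub>"] hom part_in e(2)
    by (intro R.finsum_cong') (auto simp: subset_iff)
  also have "\<dots> = e \<otimes>\<^bsub>R\<^esub> (\<Oplus>\<^bsub>R\<^esub>g\<in>support \<one>\<^bsub>R\<^esub>. part \<one>\<^bsub>R\<^esub> g)"
    using support_subset[of "\<one>\<^bsub>R\<^esub>"] finite_support e(2)
    by (intro R.finsum_rdistr[symmetric]) (auto simp: subset_iff)
  also have "(\<Oplus>\<^bsub>R\<^esub>g\<in>support \<one>\<^bsub>R\<^esub>. part \<one>\<^bsub>R\<^esub> g) = \<one>\<^bsub>R\<^esub>"
    by (rule sum_parts) (simp_all add: finite_support support_subset)
  finally show ?thesis using e by simp
qed

lemma identity_component_subset: "A \<one>\<^bsub>G\<^esub> \<subseteq> carrier R"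
  using component_closed by blast

lemma ring_identity_component: "ring (identity_component G R A)"
proof -
  have "subring (A \<one>\<^bsub>G\<^esub>) R"
    by (rule R.subringI)
      (use component_mult[of "\<one>\<^bsub>G\<^esub>" "\<one>\<^bsub>G\<^esub>"] component_add[of "\<one>\<^bsub>G\<^esub>"]
        additive_subgroup.a_inv_closed[OF component_subgroup[of "\<one>\<^bsub>G\<^esub>"]]
        one_in_identity_component identity_component_subset in simp_all)
  then show ?thesis unfolding identity_component_def by (rule R.subring_is_ring)
qed


lemma finsum_identity_component:
  "f \<in> I \<rightarrow> A \<one>\<^bsub>G\<^esub> \<Longrightarrow> finsum (identity_component G R A) f I = finsum R f I"
  using ring_identity_component identity_component_subset unfolding identity_component_def
  by (intro R.finsum_subring)

lemma identity_factors_of_identity_component: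
  assumes "identity_factors (identity_component G R A) I J"
  shows "identity_factors R I J"
proof -
  let ?S = "identity_component G R A"
  interpret S: ring ?S by (rule ring_identity_component)
  obtain F H where F: "\<And>i j. i \<in> I \<Longrightarrow> j \<in> J \<Longrightarrow> F i j \<in> carrier ?S"
    and H: "\<And>i j. i \<in> I \<Longrightarrow> j \<in> J \<Longrightarrow> H j i \<in> carrier ?S"
    and FH: "\<And>i k. i \<in> I \<Longrightarrow> k \<in> I \<Longrightarrow>
      (\<Oplus>\<^bsub>?S\<^esub>j\<in>J. F i j \<otimes>\<^bsub>?S\<^esub> H j k) = (if i = k then \<one>\<^bsub>?S\<^esub> else \<zero>\<^bsub>?S\<^esub>)"
    using assms by (rule identity_factorsE) blast
  show ?thesis unfolding identity_factors_def
  proof (rule exI[of _ F], rule exI[of _ H], intro conjI ballI)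
    fix i j assume "i \<in> I" "j \<in> J"
    then show "F i j \<in> carrier R" "H j i \<in> carrier R"
      using F H identity_component_subset by (auto simp: identity_component_def)
  next
    fix i k assume ik: "i \<in> I" "k \<in> I"
    have "(\<lambda>j. F i j \<otimes>\<^bsub>?S\<^esub> H j k) \<in> J \<rightarrow> carrier ?S" using F H ik by simp
    then have "(\<lambda>j. F i j \<otimes>\<^bsub>R\<^esub> H j k) \<in> J \<rightarrow> A \<one>\<^bsub>G\<^esub>" by (simp add: identity_component_def)
    from finsum_identity_component[OF this]
    show "(\<Oplus>\<^bsub>R\<^esub>j\<in>J. F i j \<otimes>\<^bsub>R\<^esub> H j k) = (if i = k then \<one>\<^bsub>R\<^esub> else \<zero>\<^bsub>R\<^esub>)"
      using FH[OF ik] by (simp add: identity_component_def)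
  qed
qed

lemma UGN_identity_component:
  assumes "UGN R" shows "UGN (identity_component G R A)"
  using assms identity_factors_of_identity_component
  unfolding R.UGN_iff_identity_factors ring.UGN_iff_identity_factors[OF ring_identity_component]
  by metis

end

section \<open>Coordinates in free homogeneous components\<close>

text \<open>
A grading whose components are free as right modules over the identity component: \<open>\<phi> g\<close> is an
isomorphism from the component of degree \<open>g\<close> onto the free module of rank \<open>\<rho> g\<close>.
\<close>

locale free_group_graded_ring = group_graded_ring G R A
  for G :: "('g, 'h) monoid_scheme" (structure) and R :: "('r, 'k) ring_scheme" (structure)
    and A :: "'g \<Rightarrow> 'r set" +
  fixes \<rho> :: "'g \<Rightarrow> nat" and \<phi> :: "'g \<Rightarrow> 'r \<Rightarrow> nat \<Rightarrow> 'r"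
  assumes linear: "g \<in> carrier G \<Longrightarrow> \<phi> g \<in>
      linear_maps (identity_component G R A) (right_component R (A g))
        (right_power (identity_component G R A) (\<rho> g))"
    and bijective: "g \<in> carrier G \<Longrightarrow> bij_betw (\<phi> g) (A g) ({..<\<rho> g} \<rightarrow>\<^sub>E A \<one>\<^bsub>G\<^esub>)"
begin

text \<open>
The basis elements of the components with degree in \<open>Z\<close> are indexed by the pairs of a degree \<open>g\<close> in
\<open>Z\<close> and a number less than \<open>\<rho> g\<close>. The element \<open>basis p\<close> corresponds to a standard basis vector, and
\<open>coord p x\<close> is the coordinate of \<open>x\<close> with respect to \<open>basis p\<close>. Together they form a dual basis of
\<open>R\<close> as a right module over the identity component.
\<close>

definition indices :: "'g set \<Rightarrow> ('g \<times> nat) set"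
  where "indices Z = Sigma Z (\<lambda>g. {..<\<rho> g})"

definition coord :: "'g \<times> nat \<Rightarrow> 'r \<Rightarrow> 'r"
  where "coord p x = \<phi> (fst p) (part x (fst p)) (snd p)"

definition basis :: "'g \<times> nat \<Rightarrow> 'r"
  where "basis p = inv_into (A (fst p)) (\<phi> (fst p))
    (\<lambda>k\<in>{..<\<rho> (fst p)}. if k = snd p then \<one>\<^bsub>R\<^esub> else \<zero>\<^bsub>R\<^esub>)"

abbreviation "all_indices \<equiv> indices (carrier G)"

lemma finite_indices: "finite Z \<Longrightarrow> finite (indices Z)"
  by (simp add: indices_def)

lemma card_indices: "finite Z \<Longrightarrow> card (indices Z) = (\<Sum>g\<in>Z. \<rho> g)"
  by (simp add: indices_def card_SigmaI)

lemma indices_mono: "Y \<subseteq> Z \<Longrightarrow> indices Y \<subseteq> indices Z"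
  by (auto simp: indices_def)

lemma indicesD: "p \<in> indices Z \<Longrightarrow> fst p \<in> Z \<and> snd p < \<rho> (fst p)"
  by (auto simp: indices_def)

lemma
  assumes "g \<in> carrier G"
  shows \<phi>_in: "a \<in> A g \<Longrightarrow> \<phi> g a \<in> {..<\<rho> g} \<rightarrow>\<^sub>E A \<one>\<^bsub>G\<^esub>"
    and \<phi>_add: "a \<in> A g \<Longrightarrow> b \<in> A g \<Longrightarrow> j < \<rho> g \<Longrightarrow> \<phi> g (a \<oplus>\<^bsub>R\<^esub> b) j = \<phi> g a j \<oplus>\<^bsub>R\<^esub> \<phi> g b j"
    and \<phi>_mult: "a \<in> A g \<Longrightarrow> s \<in> A \<one>\<^bsub>G\<^esub> \<Longrightarrow> j < \<rho> g \<Longrightarrow> \<phi> g (a \<otimes>\<^bsub>R\<^esub> s) j = \<phi> g a j \<otimes>\<^bsub>R\<^esub> s"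
    and \<phi>_zero: "j < \<rho> g \<Longrightarrow> \<phi> g \<zero>\<^bsub>R\<^esub> j = \<zero>\<^bsub>R\<^esub>"
proof -
  note lin = linear[OF assms]
  show into: "\<phi> g a \<in> {..<\<rho> g} \<rightarrow>\<^sub>E A \<one>\<^bsub>G\<^esub>" if "a \<in> A g" for a
    using bijective[OF assms] that by (rule bij_betwE[THEN bspec])
  show add: "\<phi> g (a \<oplus>\<^bsub>R\<^esub> b) j = \<phi> g a j \<oplus>\<^bsub>R\<^esub> \<phi> g b j" if "a \<in> A g" "b \<in> A g" "j < \<rho> g" for a b j
    using lin that
    by (simp add: linear_maps_def right_component_def right_power_simps identity_component_def)
  show "\<phi> g (a \<otimes>\<^bsub>R\<^esub> s) j = \<phi> g a j \<otimes>\<^bsub>R\<^esub> s" if "a \<in> A g" "s \<in> A \<one>\<^bsub>G\<^esub>" "j < \<rho> g"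
    using lin that
    by (simp add: linear_maps_def right_component_def right_power_simps identity_component_def)
  show "\<phi> g \<zero>\<^bsub>R\<^esub> j = \<zero>\<^bsub>R\<^esub>" if j: "j < \<rho> g"
  proof -
    have "\<phi> g \<zero>\<^bsub>R\<^esub> j \<in> carrier R"
      using PiE_mem[OF into[OF zero_in_component[OF assms]], of j] j identity_component_subset by auto
    moreover have "\<phi> g \<zero>\<^bsub>R\<^esub> j \<oplus>\<^bsub>R\<^esub> \<phi> g \<zero>\<^bsub>R\<^esub> j = \<phi> g \<zero>\<^bsub>R\<^esub> j"
      using add[of "\<zero>\<^bsub>R\<^esub>" "\<zero>\<^bsub>R\<^esub>" j] zero_in_component[OF assms] j by simp
    ultimately show ?thesis by simp
  qed
qed

lemma coord_in: "p \<in> all_indices \<Longrightarrow> x \<in> carrier R \<Longrightarrow> coord p x \<in> A \<one>\<^bsub>G\<^esub>"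
  using PiE_mem[OF \<phi>_in[OF _ part_in], of "fst p" x "snd p"]
  by (simp add: coord_def indicesD)

lemma coord_closed: "p \<in> all_indices \<Longrightarrow> x \<in> carrier R \<Longrightarrow> coord p x \<in> carrier R"
  using coord_in identity_component_subset by blast

lemma coord_add:
  "p \<in> all_indices \<Longrightarrow> x \<in> carrier R \<Longrightarrow> y \<in> carrier R \<Longrightarrow>
    coord p (x \<oplus>\<^bsub>R\<^esub> y) = coord p x \<oplus>\<^bsub>R\<^esub> coord p y"
  by (simp add: coord_def part_add part_in \<phi>_add indicesD)

lemma coord_mult:
  assumes "p \<in> all_indices" "x \<in> carrier R" "s \<in> A \<one>\<^bsub>G\<^esub>"
  shows "coord p (x \<otimes>\<^bsub>R\<^esub> s) = coord p x \<otimes>\<^bsub>R\<^esub> s"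
  using part_mult_homogeneous[OF assms(2,3), of "fst p"] assms indicesD[OF assms(1)]
  by (simp add: coord_def part_in \<phi>_mult)

lemma coord_finsum:
  assumes "p \<in> all_indices" "f \<in> I \<rightarrow> carrier R"
  shows "coord p (\<Oplus>\<^bsub>R\<^esub>i\<in>I. f i) = (\<Oplus>\<^bsub>R\<^esub>i\<in>I. coord p (f i))"
  using assms coord_closed coord_add by (intro R.additive_finsum) simp_all

lemma coord_outside_support:
  "p \<in> all_indices \<Longrightarrow> fst p \<notin> support x \<Longrightarrow> coord p x = \<zero>\<^bsub>R\<^esub>"
  by (simp add: coord_def support_def indicesD \<phi>_zero)

lemma coord_zero: "p \<in> all_indices \<Longrightarrow> coord p \<zero>\<^bsub>R\<^esub> = \<zero>\<^bsub>R\<^esub>"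
  using coord_closed coord_add by (intro R.additive_zero) simp_all

lemma
  assumes "p \<in> all_indices"
  shows basis_in: "basis p \<in> A (fst p)"
    and \<phi>_basis: "\<phi> (fst p) (basis p) =
      (\<lambda>k\<in>{..<\<rho> (fst p)}. if k = snd p then \<one>\<^bsub>R\<^esub> else \<zero>\<^bsub>R\<^esub>)"
proof -
  have g: "fst p \<in> carrier G" using indicesD[OF assms] by simp
  have "(\<lambda>k\<in>{..<\<rho> (fst p)}. if k = snd p then \<one>\<^bsub>R\<^esub> else \<zero>\<^bsub>R\<^esub>) \<in> {..<\<rho> (fst p)} \<rightarrow>\<^sub>E A \<one>\<^bsub>G\<^esub>"
    using one_in_identity_component zero_in_component by (simp add: restrict_PiE_iff)
  then have *: "(\<lambda>k\<in>{..<\<rho> (fst p)}. if k = snd p then \<one>\<^bsub>R\<^esub> else \<zero>\<^bsub>R\<^esub>) \<in> \<phi> (fst p) ` A (fst p)"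
    using bijective[OF g] by (simp only: bij_betw_def)
  show "basis p \<in> A (fst p)" unfolding basis_def by (rule inv_into_into[OF *])
  show "\<phi> (fst p) (basis p) =
      (\<lambda>k\<in>{..<\<rho> (fst p)}. if k = snd p then \<one>\<^bsub>R\<^esub> else \<zero>\<^bsub>R\<^esub>)"
    unfolding basis_def by (rule f_inv_into_f[OF *])
qed

lemma basis_closed: "p \<in> all_indices \<Longrightarrow> basis p \<in> carrier R"
  using component_closed[OF _ basis_in] indicesD by blast

lemma coord_basis:
  assumes "p \<in> all_indices" "q \<in> all_indices"
  shows "coord p (basis q) = (if q = p then \<one>\<^bsub>R\<^esub> else \<zero>\<^bsub>R\<^esub>)"
proof (cases "fst p = fst q")
  case True
  then show ?thesis
    using part_homogeneous[OF _ basis_in, of q "fst q"] assms indicesD[OF assms(1)] indicesD[OF assms(2)]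
      \<phi>_basis[OF assms(2)]
    by (auto simp: coord_def prod_eq_iff)
next
  case False
  then show ?thesis
    using part_homogeneous[OF _ basis_in, of q "fst p"] assms indicesD[OF assms(1)] indicesD[OF assms(2)]
    by (auto simp: coord_def \<phi>_zero)
qed

lemma coord_separates:
  assumes x: "x \<in> carrier R" and y: "y \<in> carrier R"
    and eq: "\<And>p. p \<in> all_indices \<Longrightarrow> coord p x = coord p y"
  shows "x = y"
proof -
  have part_eq: "part x g = part y g" if g: "g \<in> carrier G" for g
  proof -
    have "\<phi> g (part x g) = \<phi> g (part y g)"
    proof (rule PiE_ext[OF \<phi>_in[OF g part_in[OF x g]] \<phi>_in[OF g part_in[OF y g]]])
      fix j assume "j \<in> {..<\<rho> g}"
      then show "\<phi> g (part x g) j = \<phi> g (part y g) j"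
        using eq[of "(g, j)"] g by (simp add: coord_def indices_def)
    qed
    then show ?thesis
      using bijective[OF g] part_in[OF x g] part_in[OF y g] by (auto simp: bij_betw_def dest: inj_onD)
  qed
  then have supp: "support x = support y" by (auto simp: support_def)
  have "x = (\<Oplus>\<^bsub>R\<^esub>g\<in>support x. part x g)"
    using sum_parts[OF x finite_support[OF x] support_subset] by simp
  also have "\<dots> = (\<Oplus>\<^bsub>R\<^esub>g\<in>support x. part y g)"
    using y support_subset[of x] part_eq by (intro R.finsum_cong') (auto simp: subset_iff)
  also have "\<dots> = y"
    unfolding supp using sum_parts[OF y finite_support[OF y] support_subset] by simp
  finally show ?thesis .
qed

text \<open>
Both sides have the same coordinates, so they agree.
\<close>

lemma basis_expansion:
  assumes x: "x \<in> carrier R" and Z: "finite Z" "Z \<subseteq> carrier G" "support x \<subseteq> Z"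
  shows "(\<Oplus>\<^bsub>R\<^esub>q\<in>indices Z. basis q \<otimes>\<^bsub>R\<^esub> coord q x) = x"
proof (rule coord_separates[OF _ x])
  have sub: "q \<in> all_indices" if "q \<in> indices Z" for q using indices_mono[OF Z(2)] that by blast
  have cl: "(\<lambda>q. basis q \<otimes>\<^bsub>R\<^esub> coord q x) \<in> indices Z \<rightarrow> carrier R"
    using sub basis_closed coord_closed x by simp
  show "(\<Oplus>\<^bsub>R\<^esub>q\<in>indices Z. basis q \<otimes>\<^bsub>R\<^esub> coord q x) \<in> carrier R"
    using cl by (rule R.finsum_closed)
  fix p assume p: "p \<in> all_indices"
  have "coord p (\<Oplus>\<^bsub>R\<^esub>q\<in>indices Z. basis q \<otimes>\<^bsub>R\<^esub> coord q x)
      = (\<Oplus>\<^bsub>R\<^esub>q\<in>indices Z. coord p (basis q \<otimes>\<^bsub>R\<^esub> coord q x))"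
    by (rule coord_finsum[OF p cl])
  also have "\<dots> = (\<Oplus>\<^bsub>R\<^esub>q\<in>indices Z. if q = p then coord p x else \<zero>\<^bsub>R\<^esub>)"
    using p sub x coord_closed coord_in basis_closed
    by (intro R.finsum_cong') (auto simp: coord_mult coord_basis)
  also have "\<dots> = coord p x"
  proof (cases "p \<in> indices Z")
    case True
    then show ?thesis
      using finite_indices[OF Z(1)] coord_closed[OF p x] by (intro R.finsum_delta)
  next
    case False
    then have "fst p \<notin> support x" using p Z(3) by (auto simp: indices_def)
    then have zero: "coord p x = \<zero>\<^bsub>R\<^esub>" by (rule coord_outside_support[OF p])
    show ?thesis unfolding zero by simp
  qed
  finally show "coord p (\<Oplus>\<^bsub>R\<^esub>q\<in>indices Z. basis q \<otimes>\<^bsub>R\<^esub> coord q x) = coord p x" .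
qed

lemma support_mult_basis:
  assumes "a \<in> carrier R" "p \<in> all_indices" "support a \<subseteq> L" "fst p \<in> Y"
  shows "support (a \<otimes>\<^bsub>R\<^esub> basis p) \<subseteq> L <#>\<^bsub>G\<^esub> Y"
proof
  fix k assume "k \<in> support (a \<otimes>\<^bsub>R\<^esub> basis p)"
  then have k: "k \<in> carrier G" "part (a \<otimes>\<^bsub>R\<^esub> basis p) k \<noteq> \<zero>\<^bsub>R\<^esub>" by (simp_all add: support_def)
  have h: "fst p \<in> carrier G" using indicesD[OF assms(2)] by simp
  define g where "g = k \<otimes>\<^bsub>G\<^esub> inv\<^bsub>G\<^esub> (fst p)"
  have g: "g \<in> carrier G" "k = g \<otimes>\<^bsub>G\<^esub> fst p" using k(1) h by (simp_all add: g_def G.m_assoc)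
  have "part a g \<otimes>\<^bsub>R\<^esub> basis p \<noteq> \<zero>\<^bsub>R\<^esub>"
    using k(2) part_mult_homogeneous[OF assms(1) basis_in[OF assms(2)] h g(1)] g(2) by simp
  then have "part a g \<noteq> \<zero>\<^bsub>R\<^esub>" using basis_closed[OF assms(2)] by auto
  then have "g \<in> L" using g(1) assms(3) by (auto simp: support_def)
  then show "k \<in> L <#>\<^bsub>G\<^esub> Y" using g(2) assms(4) by (auto simp: set_mult_def)
qed

text \<open>
This is the passage from \<open>R\<close> to its identity component. Multiplication by \<open>H\<close> maps vectors with
support in \<open>Y\<close> to vectors with support in \<open>L Y\<close>, where \<open>L\<close> contains the supports of all entries of
\<open>H\<close>; multiplication by \<open>F\<close>, followed by the projection to the components with degree in \<open>Y\<close>, undoes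
this. The matrices of the two maps in the bases above factor the identity. No control over
the supports of the entries of \<open>F\<close> is needed.
\<close>

lemma identity_factors_descend:
  assumes "identity_factors R I K" and I: "finite I" and K: "finite K"
  obtains L where "finite L" "L \<subseteq> carrier G"
    "\<And>Y. finite Y \<Longrightarrow> Y \<subseteq> carrier G \<Longrightarrow>
      identity_factors (identity_component G R A) (I \<times> indices Y) (K \<times> indices (L <#>\<^bsub>G\<^esub> Y))"
proof -
  let ?S = "identity_component G R A"
  obtain F H where F: "\<And>i k. i \<in> I \<Longrightarrow> k \<in> K \<Longrightarrow> F i k \<in> carrier R"
    and H: "\<And>i k. i \<in> I \<Longrightarrow> k \<in> K \<Longrightarrow> H k i \<in> carrier R"
    and FH: "\<And>i j. i \<in> I \<Longrightarrow> j \<in> I \<Longrightarrow>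
      (\<Oplus>\<^bsub>R\<^esub>k\<in>K. F i k \<otimes>\<^bsub>R\<^esub> H k j) = (if i = j then \<one>\<^bsub>R\<^esub> else \<zero>\<^bsub>R\<^esub>)"
    using assms(1) by (rule identity_factorsE) blast
  define L where "L = (\<Union>i\<in>I. \<Union>k\<in>K. support (H k i))"
  have L: "finite L" "L \<subseteq> carrier G"
    using I K H finite_support support_subset by (auto simp: L_def subset_iff)
  show thesis
  proof (rule that[OF L])
    fix Y assume Y: "finite Y" "Y \<subseteq> carrier G"
    let ?Z = "L <#>\<^bsub>G\<^esub> Y"
    have Z: "finite ?Z" "?Z \<subseteq> carrier G"
      using L Y by (auto simp: set_mult_def)
    have inY: "p \<in> all_indices" "fst p \<in> Y" if "p \<in> indices Y" for p
      using that indices_mono[OF Y(2)] by (auto simp: indices_def)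
    have inZ: "q \<in> all_indices" if "q \<in> indices ?Z" for q
      using that indices_mono[OF Z(2)] by blast
    define F' where "F' u v = coord (snd u) (F (fst u) (fst v) \<otimes>\<^bsub>R\<^esub> basis (snd v))" for u v
    define H' where "H' v u = coord (snd v) (H (fst v) (fst u) \<otimes>\<^bsub>R\<^esub> basis (snd u))" for u v
    have F'_in: "F' u v \<in> A \<one>\<^bsub>G\<^esub>" if "u \<in> I \<times> indices Y" "v \<in> K \<times> indices ?Z" for u v
      using that F inY inZ basis_closed unfolding F'_def by (intro coord_in) auto
    have H'_in: "H' v u \<in> A \<one>\<^bsub>G\<^esub>" if "u \<in> I \<times> indices Y" "v \<in> K \<times> indices ?Z" for u v
      using that H inY inZ basis_closed unfolding H'_def by (intro coord_in) auto
    show "identity_factors ?S (I \<times> indices Y) (K \<times> indices ?Z)"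
      unfolding identity_factors_def
    proof (rule exI[of _ F'], rule exI[of _ H'], intro conjI ballI)
      fix u v assume "u \<in> I \<times> indices Y" "v \<in> K \<times> indices ?Z"
      then show "F' u v \<in> carrier ?S" "H' v u \<in> carrier ?S"
        using F'_in H'_in by (simp_all add: identity_component_def)
    next
      fix u w assume u: "u \<in> I \<times> indices Y" and w: "w \<in> I \<times> indices Y"
      obtain i p where ip: "u = (i, p)" "i \<in> I" "p \<in> indices Y" using u by auto
      obtain j r where jr: "w = (j, r)" "j \<in> I" "r \<in> indices Y" using w by auto
      note p = inY[OF ip(3)] and r = inY[OF jr(3)]
      have Hr: "H k j \<otimes>\<^bsub>R\<^esub> basis r \<in> carrier R" if "k \<in> K" for k
        using H jr(2) r(1) basis_closed that by simp
      let ?f = "\<lambda>k q. F i k \<otimes>\<^bsub>R\<^esub> basis q \<otimes>\<^bsub>R\<^esub> coord q (H k j \<otimes>\<^bsub>R\<^esub> basis r)"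
      have f_cl: "?f k q \<in> carrier R" if "k \<in> K" "q \<in> indices ?Z" for k q
        using F ip(2) that inZ basis_closed coord_closed Hr by simp
      have inner: "(\<Oplus>\<^bsub>R\<^esub>q\<in>indices ?Z. ?f k q) = F i k \<otimes>\<^bsub>R\<^esub> H k j \<otimes>\<^bsub>R\<^esub> basis r" if k: "k \<in> K" for k
      proof -
        have "(\<Oplus>\<^bsub>R\<^esub>q\<in>indices ?Z. ?f k q)
            = (\<Oplus>\<^bsub>R\<^esub>q\<in>indices ?Z. F i k \<otimes>\<^bsub>R\<^esub> (basis q \<otimes>\<^bsub>R\<^esub> coord q (H k j \<otimes>\<^bsub>R\<^esub> basis r)))"
          using F ip(2) k inZ basis_closed coord_closed Hr
          by (intro R.finsum_cong') (auto simp: R.m_assoc)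
        also have "\<dots> = F i k \<otimes>\<^bsub>R\<^esub> (\<Oplus>\<^bsub>R\<^esub>q\<in>indices ?Z. basis q \<otimes>\<^bsub>R\<^esub> coord q (H k j \<otimes>\<^bsub>R\<^esub> basis r))"
          using F ip(2) k inZ basis_closed coord_closed Hr finite_indices[OF Z(1)]
          by (intro R.finsum_rdistr[symmetric]) auto
        also have "(\<Oplus>\<^bsub>R\<^esub>q\<in>indices ?Z. basis q \<otimes>\<^bsub>R\<^esub> coord q (H k j \<otimes>\<^bsub>R\<^esub> basis r)) = H k j \<otimes>\<^bsub>R\<^esub> basis r"
        proof (rule basis_expansion[OF Hr[OF k] Z])
          have "support (H k j) \<subseteq> L" using k jr(2) by (auto simp: L_def)
          then show "support (H k j \<otimes>\<^bsub>R\<^esub> basis r) \<subseteq> ?Z"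
            using H jr(2) k r by (intro support_mult_basis) auto
        qed
        finally show ?thesis using F H ip(2) jr(2) k r(1) basis_closed by (simp add: R.m_assoc)
      qed
      have "(\<Oplus>\<^bsub>?S\<^esub>v\<in>K \<times> indices ?Z. F' u v \<otimes>\<^bsub>?S\<^esub> H' v w)
          = (\<Oplus>\<^bsub>R\<^esub>v\<in>K \<times> indices ?Z. F' u v \<otimes>\<^bsub>R\<^esub> H' v w)"
      proof -
        have "F' u v \<otimes>\<^bsub>R\<^esub> H' v w \<in> A \<one>\<^bsub>G\<^esub>" if "v \<in> K \<times> indices ?Z" for v
          using component_mult[OF _ _ F'_in[OF u that] H'_in[OF w that]] by simp
        then show ?thesis
          using finsum_identity_component[of "\<lambda>v. F' u v \<otimes>\<^bsub>R\<^esub> H' v w" "K \<times> indices ?Z"]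
          by (simp add: identity_component_def)
      qed
      also have "\<dots> = (\<Oplus>\<^bsub>R\<^esub>v\<in>K \<times> indices ?Z. coord p (?f (fst v) (snd v)))"
      proof (rule R.finsum_cong'[OF refl])
        show "(\<lambda>v. coord p (?f (fst v) (snd v))) \<in> K \<times> indices ?Z \<rightarrow> carrier R"
          using f_cl coord_closed[OF p(1)] by auto
        fix v assume v: "v \<in> K \<times> indices ?Z"
        then have "F i (fst v) \<otimes>\<^bsub>R\<^esub> basis (snd v) \<in> carrier R"
          using F ip(2) inZ basis_closed by auto
        then show "F' u v \<otimes>\<^bsub>R\<^esub> H' v w = coord p (?f (fst v) (snd v))"
          using coord_mult[OF p(1) _ H'_in[OF w v]] by (simp add: F'_def H'_def ip(1) jr(1))
      qed
      also have "\<dots> = coord p (\<Oplus>\<^bsub>R\<^esub>v\<in>K \<times> indices ?Z. ?f (fst v) (snd v))"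
        using f_cl by (intro coord_finsum[symmetric] p(1)) auto
      also have "(\<Oplus>\<^bsub>R\<^esub>v\<in>K \<times> indices ?Z. ?f (fst v) (snd v)) = (\<Oplus>\<^bsub>R\<^esub>k\<in>K. \<Oplus>\<^bsub>R\<^esub>q\<in>indices ?Z. ?f k q)"
        using f_cl by (intro R.finsum_Times K finite_indices Z(1))
      also have "\<dots> = (\<Oplus>\<^bsub>R\<^esub>k\<in>K. F i k \<otimes>\<^bsub>R\<^esub> H k j \<otimes>\<^bsub>R\<^esub> basis r)"
        using F H ip(2) jr(2) r(1) basis_closed inner by (intro R.finsum_cong') auto
      also have "\<dots> = (\<Oplus>\<^bsub>R\<^esub>k\<in>K. F i k \<otimes>\<^bsub>R\<^esub> H k j) \<otimes>\<^bsub>R\<^esub> basis r"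
        using F H ip(2) jr(2) r(1) basis_closed K by (intro R.finsum_ldistr[symmetric]) auto
      also have "\<dots> = (if i = j then basis r else \<zero>\<^bsub>R\<^esub>)"
        using FH[OF ip(2) jr(2)] basis_closed[OF r(1)] by simp
      also have "coord p \<dots> = (if u = w then \<one>\<^bsub>?S\<^esub> else \<zero>\<^bsub>?S\<^esub>)"
        using coord_basis[OF p(1) r(1)] coord_zero[OF p(1)]
        by (auto simp: ip(1) jr(1) identity_component_def)
      finally show "(\<Oplus>\<^bsub>?S\<^esub>v\<in>K \<times> indices ?Z. F' u v \<otimes>\<^bsub>?S\<^esub> H' v w)
          = (if u = w then \<one>\<^bsub>?S\<^esub> else \<zero>\<^bsub>?S\<^esub>)" .
    qed
  qed
qed

lemma rank_growth:
  assumes "UGN (identity_component G R A)" "identity_factors R {..<m} {..<n::nat}"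
  obtains L where "finite L" "L \<subseteq> carrier G"
    "\<And>Y. finite Y \<Longrightarrow> Y \<subseteq> carrier G \<Longrightarrow> m * sum \<rho> Y \<le> n * sum \<rho> (L <#>\<^bsub>G\<^esub> Y)"
proof -
  obtain L where L: "finite L" "L \<subseteq> carrier G" and
    desc: "\<And>Y. finite Y \<Longrightarrow> Y \<subseteq> carrier G \<Longrightarrow> identity_factors (identity_component G R A)
      ({..<m} \<times> indices Y) ({..<n} \<times> indices (L <#>\<^bsub>G\<^esub> Y))"
    using identity_factors_descend[OF assms(2)] by blast
  show thesis
  proof (rule that[OF L])
    fix Y assume Y: "finite Y" "Y \<subseteq> carrier G"
    have Z: "finite (L <#>\<^bsub>G\<^esub> Y)" using L(1) Y(1) by (auto simp: set_mult_def)
    have "card ({..<m} \<times> indices Y) \<le> card ({..<n} \<times> indices (L <#>\<^bsub>G\<^esub> Y))"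
      by (intro ring.identity_factors_card_le[OF ring_identity_component assms(1) _ _ desc[OF Y]]
          finite_cartesian_product finite_indices Y Z finite_lessThan)
    then show "m * sum \<rho> Y \<le> n * sum \<rho> (L <#>\<^bsub>G\<^esub> Y)"
      by (simp add: card_cartesian_product card_indices Y Z)
  qed
qed

text \<open>
Iteration replaces the growth factor \<open>m / n\<close> by any of its powers.
\<close>

lemma rank_growth_power:
  assumes L: "finite L" "L \<subseteq> carrier G"
    and growth: "\<And>Y. finite Y \<Longrightarrow> Y \<subseteq> carrier G \<Longrightarrow> m * sum \<rho> Y \<le> n * sum \<rho> (L <#>\<^bsub>G\<^esub> Y)"
  shows "\<exists>M. finite M \<and> M \<subseteq> carrier G \<and>
    (\<forall>Y. finite Y \<longrightarrow> Y \<subseteq> carrier G \<longrightarrow> m ^ k * sum \<rho> Y \<le> n ^ k * sum \<rho> (M <#>\<^bsub>G\<^esub> Y))"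
proof (induction k)
  case 0
  have "{\<one>\<^bsub>G\<^esub>} <#>\<^bsub>G\<^esub> Y = Y" if "Y \<subseteq> carrier G" for Y
    using that by (force simp: set_mult_def)
  then show ?case by (intro exI[of _ "{\<one>\<^bsub>G\<^esub>}"]) simp
next
  case (Suc k)
  then obtain M where M: "finite M" "M \<subseteq> carrier G" and
    IH: "\<And>Y. finite Y \<Longrightarrow> Y \<subseteq> carrier G \<Longrightarrow> m ^ k * sum \<rho> Y \<le> n ^ k * sum \<rho> (M <#>\<^bsub>G\<^esub> Y)"
    by blast
  have "m ^ Suc k * sum \<rho> Y \<le> n ^ Suc k * sum \<rho> ((M <#>\<^bsub>G\<^esub> L) <#>\<^bsub>G\<^esub> Y)"
    if Y: "finite Y" "Y \<subseteq> carrier G" for Y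
  proof -
    have LY: "finite (L <#>\<^bsub>G\<^esub> Y)" "L <#>\<^bsub>G\<^esub> Y \<subseteq> carrier G"
      using L Y by (auto simp: set_mult_def)
    have "m ^ Suc k * sum \<rho> Y \<le> m ^ k * (n * sum \<rho> (L <#>\<^bsub>G\<^esub> Y))"
      using mult_le_mono2[OF growth[OF Y], of "m ^ k"] by (simp add: mult_ac)
    also have "\<dots> \<le> n * (n ^ k * sum \<rho> (M <#>\<^bsub>G\<^esub> (L <#>\<^bsub>G\<^esub> Y)))"
      using mult_le_mono2[OF IH[OF LY], of n] by (simp add: mult_ac)
    finally show ?thesis using G.set_mult_assoc[OF M(2) L(2) Y(2)] by (simp add: mult_ac)
  qed
  moreover have "finite (M <#>\<^bsub>G\<^esub> L)" "M <#>\<^bsub>G\<^esub> L \<subseteq> carrier G"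
    using L M by (auto simp: set_mult_def)
  ultimately show ?case by blast
qed

text \<open>
The powers of \<open>(n + 1) / n\<close> exceed \<open>2 r\<close>. Since the ranks are at most \<open>r\<close>, and at least \<open>1\<close> on the set
\<open>V\<close> of degrees with nonzero rank, growth of ranks by the factor \<open>2 r\<close> doubles the number of
elements of finite subsets of \<open>V\<close>, and \<open>V\<close> is not amenable.
\<close>

lemma UGN_of_identity_component:
  assumes supra: "supramenable G" and UGN: "UGN (identity_component G R A)"
    and bound: "\<And>g. g \<in> carrier G \<Longrightarrow> \<rho> g \<le> r"
  shows "UGN R"
proof (rule ccontr)
  interpret S: ring "identity_component G R A" by (rule ring_identity_component)
  assume "\<not> UGN R"
  then obtain n where n: "n > 0" and fact: "identity_factors R {..<Suc n} {..<n}"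
    by (auto simp: R.UGN_iff_identity_factors)
  obtain L where L: "finite L" "L \<subseteq> carrier G" and
    growth: "\<And>Y. finite Y \<Longrightarrow> Y \<subseteq> carrier G \<Longrightarrow> Suc n * sum \<rho> Y \<le> n * sum \<rho> (L <#>\<^bsub>G\<^esub> Y)"
    using rank_growth[OF UGN fact] by blast
  obtain k where k: "2 * r * n ^ k \<le> Suc n ^ k"
  proof -
    obtain k where "real (2 * r) < (real (Suc n) / real n) ^ k"
      using real_arch_pow[of "real (Suc n) / real n" "real (2 * r)"] n by auto
    then have "real (2 * r * n ^ k) \<le> real (Suc n ^ k)"
      using n by (simp add: power_divide field_simps)
    then have "2 * r * n ^ k \<le> Suc n ^ k" by (simp only: of_nat_le_iff)
    then show thesis by (rule that)
  qed
  obtain M where M: "finite M" "M \<subseteq> carrier G" and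
    M_growth: "\<And>Y. finite Y \<Longrightarrow> Y \<subseteq> carrier G \<Longrightarrow>
      Suc n ^ k * sum \<rho> Y \<le> n ^ k * sum \<rho> (M <#>\<^bsub>G\<^esub> Y)"
    using rank_growth_power[OF L growth, of k] by blast
  define V where "V = {g \<in> carrier G. \<rho> g > 0}"
  have "V \<noteq> {}"
  proof
    assume "V = {}"
    \<comment> \<open>The expansion of the unit in the basis is then an empty sum.\<close>
    then have "indices (support \<one>\<^bsub>R\<^esub>) = {}" using support_subset by (auto simp: indices_def V_def subset_iff)
    then have "\<one>\<^bsub>R\<^esub> = \<zero>\<^bsub>R\<^esub>"
      using basis_expansion[OF _ finite_support support_subset, of "\<one>\<^bsub>R\<^esub>" "\<one>\<^bsub>R\<^esub>"] by simp
    then show False using S.UGN_nonzero[OF UGN] by (simp add: identity_component_def)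
  qed
  moreover have V: "V \<subseteq> carrier G" by (auto simp: V_def)
  moreover have "2 * card Y \<le> card ((M <#>\<^bsub>G\<^esub> Y) \<inter> V)" if Y: "finite Y" "Y \<subseteq> V" for Y
  proof -
    let ?Z = "M <#>\<^bsub>G\<^esub> Y"
    have Y': "Y \<subseteq> carrier G" using Y(2) V by blast
    have Z: "finite ?Z" "?Z \<subseteq> carrier G" using M Y(1) Y' by (auto simp: set_mult_def)
    have "card Y = (\<Sum>g\<in>Y. 1)" by simp
    also have "\<dots> \<le> sum \<rho> Y" using Y(2) by (intro sum_mono) (auto simp: V_def)
    finally have lower: "card Y \<le> sum \<rho> Y" .
    have "sum \<rho> ?Z = sum \<rho> (?Z \<inter> V)"
      using Z by (intro sum.mono_neutral_right) (auto simp: V_def)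
    also have "\<dots> \<le> r * card (?Z \<inter> V)"
      using sum_bounded_above[of "?Z \<inter> V" \<rho> r] bound V by (auto simp: mult.commute)
    finally have upper: "sum \<rho> ?Z \<le> r * card (?Z \<inter> V)" .
    have "n ^ k * (2 * r * sum \<rho> Y) = 2 * r * n ^ k * sum \<rho> Y" by (simp only: mult_ac)
    also have "\<dots> \<le> Suc n ^ k * sum \<rho> Y" by (rule mult_le_mono1[OF k])
    also have "\<dots> \<le> n ^ k * sum \<rho> ?Z" by (rule M_growth[OF Y(1) Y'])
    finally have *: "2 * r * sum \<rho> Y \<le> sum \<rho> ?Z" using n by simp
    have "r * (2 * card Y) = 2 * r * card Y" by (simp only: mult_ac)
    also have "\<dots> \<le> 2 * r * sum \<rho> Y" by (rule mult_le_mono2[OF lower])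
    also note *
    also note upper
    finally have "r * (2 * card Y) \<le> r * card (?Z \<inter> V)" .
    moreover have "r > 0" using \<open>V \<noteq> {}\<close> bound by (force simp: V_def)
    ultimately show ?thesis by simp
  qed
  ultimately have "\<not> amenable_subset G V"
    using doubling_not_amenable[OF G.is_group _ M, of V] by blast
  then show False using supra V \<open>V \<noteq> {}\<close> by (simp add: supramenable_def)
qed

end

section \<open>Opposite structures\<close>

text \<open>
The multiplication is reversed and all other fields are kept. This covers groups and rings alike,
because the record type of rings extends that of monoids.
\<close>

definition opposite :: "('a, 'b) monoid_scheme \<Rightarrow> ('a, 'b) monoid_scheme"
  where "opposite G = G\<lparr>mult := \<lambda>x y. y \<otimes>\<^bsub>G\<^esub> x\<rparr>"

lemma opposite_simps [simp]:
  "carrier (opposite G) = carrier G" "x \<otimes>\<^bsub>opposite G\<^esub> y = y \<otimes>\<^bsub>G\<^esub> x" "\<one>\<^bsub>opposite G\<^esub> = \<one>\<^bsub>G\<^esub>"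
  by (simp_all add: opposite_def)

lemma group_opposite:
  assumes "group G" shows "group (opposite G)"
proof -
  interpret group G by fact
  show ?thesis
  proof (rule groupI)
    fix x assume "x \<in> carrier (opposite G)"
    then show "\<exists>y\<in>carrier (opposite G). y \<otimes>\<^bsub>opposite G\<^esub> x = \<one>\<^bsub>opposite G\<^esub>"
      by (intro bexI[of _ "inv\<^bsub>G\<^esub> x"]) simp_all
  qed (simp_all add: m_assoc)
qed

text \<open>
Inversion exchanges left and right translations.
\<close>

lemma supramenable_opposite:
  assumes "group G" "supramenable G" shows "supramenable (opposite G)"
  unfolding supramenable_def
proof (intro allI impI)
  interpret group G by fact
  fix Y assume Y: "Y \<subseteq> carrier (opposite G)" "Y \<noteq> {}"
  let ?i = "m_inv G"
  have "?i ` Y \<subseteq> carrier G" "?i ` Y \<noteq> {}" using Y by auto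
  then obtain \<mu> where \<mu>: "invariant_measure G \<mu>" "\<mu> (?i ` Y) = 1"
    using assms(2) by (auto simp: supramenable_def amenable_subset_iff)
  have coset: "?i ` (g <#\<^bsub>opposite G\<^esub> B) = ?i g <#\<^bsub>G\<^esub> (?i ` B)"
    if "B \<subseteq> carrier G" "g \<in> carrier G" for B g
    using that by (force simp: l_coset_def inv_mult_group)
  have "invariant_measure (opposite G) (\<lambda>B. \<mu> (?i ` B))"
    unfolding invariant_measure_def
  proof (intro conjI allI impI)
    fix B C assume BC: "B \<subseteq> carrier (opposite G)" "C \<subseteq> carrier (opposite G)" "B \<inter> C = {}"
    have "?i ` B \<inter> ?i ` C = ?i ` (B \<inter> C)"
      using BC by (intro inj_on_image_Int[symmetric, OF inv_inj]) auto
    moreover have "?i ` B \<subseteq> carrier G" "?i ` C \<subseteq> carrier G" using BC by auto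
    ultimately show "\<mu> (?i ` (B \<union> C)) = \<mu> (?i ` B) + \<mu> (?i ` C)"
      using \<mu>(1) BC(3) by (simp add: invariant_measure_def image_Un)
  next
    fix B g assume Bg: "B \<subseteq> carrier (opposite G)" "g \<in> carrier (opposite G)"
    have "?i ` B \<subseteq> carrier G" using Bg by auto
    then show "\<mu> (?i ` (g <#\<^bsub>opposite G\<^esub> B)) = \<mu> (?i ` B)"
      using \<mu>(1) Bg by (simp add: coset invariant_measure_def)
  qed
  then show "amenable_subset (opposite G) Y" using \<mu>(2) by (auto simp: amenable_subset_iff)
qed

lemma opposite_ring_simps [simp]:
  fixes R :: "('r, 'k) ring_scheme"
  shows "\<zero>\<^bsub>opposite R\<^esub> = \<zero>\<^bsub>R\<^esub>" "add (opposite R) = add R"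
    "finsum (opposite R) = finsum R"
  by (simp_all add: opposite_def finsum_def fun_eq_iff)

lemma ring_opposite:
  assumes "ring R" shows "ring (opposite R)"
proof -
  interpret ring R by fact
  show ?thesis
  proof (rule ringI)
    show "abelian_group (opposite R)"
      by (rule abelian_groupI) (auto simp: a_ac intro: bexI[of _ "\<ominus>\<^bsub>R\<^esub> _"] l_neg)
    show "monoid (opposite R)" by (rule monoidI) (auto simp: m_assoc)
  qed (auto simp: l_distr r_distr)
qed

text \<open>
The two factors are transposed and exchanged.
\<close>

lemma identity_factors_opposite:
  assumes "identity_factors R I J" shows "identity_factors (opposite R) I J"
proof -
  obtain F H where "\<And>i j. i \<in> I \<Longrightarrow> j \<in> J \<Longrightarrow> F i j \<in> carrier R"
    and "\<And>i j. i \<in> I \<Longrightarrow> j \<in> J \<Longrightarrow> H j i \<in> carrier R"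
    and "\<And>i k. i \<in> I \<Longrightarrow> k \<in> I \<Longrightarrow>
      (\<Oplus>\<^bsub>R\<^esub>j\<in>J. F i j \<otimes>\<^bsub>R\<^esub> H j k) = (if i = k then \<one>\<^bsub>R\<^esub> else \<zero>\<^bsub>R\<^esub>)"
    using assms by (rule identity_factorsE) blast
  then show ?thesis unfolding identity_factors_def
    by (intro exI[of _ "\<lambda>i j. H j i"], intro exI[of _ "\<lambda>j i. F i j"]) auto
qed

lemma opposite_opposite [simp]: "opposite (opposite G) = G"
  by (simp add: opposite_def)

lemma UGN_opposite:
  assumes "ring R" shows "UGN (opposite R) \<longleftrightarrow> UGN R"
proof -
  have "identity_factors (opposite R) I J \<longleftrightarrow> identity_factors R I J" for I J :: "nat set"
    using identity_factors_opposite[of R I J] identity_factors_opposite[of "opposite R" I J] by auto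
  then show ?thesis
    by (simp add: ring.UGN_iff_identity_factors assms ring_opposite)
qed

lemma group_grading_opposite:
  assumes "group_grading G R A" shows "group_grading (opposite G) (opposite R) A"
proof -
  have "additive_subgroup B (opposite R) \<longleftrightarrow> additive_subgroup B R" for B
    by (simp add: additive_subgroup_def opposite_def)
  then show ?thesis using assms by (simp add: group_grading_def)
qed

lemma identity_component_opposite:
  "identity_component (opposite G) (opposite R) A = opposite (identity_component G R A)"
  by (simp add: identity_component_def opposite_def)

text \<open>
Left modules over a ring are right modules over the opposite ring. The map sets agree because
linearity only refers to the carrier of the scalar ring.
\<close>

lemma right_module_opposite:
  "linear_maps (opposite S) = linear_maps S"
  "right_component (opposite R) B = left_component R B"
  "right_power (opposite S) n = left_power S n"
  by (simp_all add: fun_eq_iff linear_maps_def right_component_def left_component_def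
      right_power_def left_power_def)

section \<open>Boundedly free gradings\<close>

lemma UGN_iff_of_right_free:
  assumes "group G" "supramenable G" "ring R" "group_grading G R A"
    and free: "\<And>g. g \<in> carrier G \<Longrightarrow> \<exists>i\<in>{0..r}. module_isomorphic (identity_component G R A)
      (right_component R (A g)) (right_power (identity_component G R A) i)"
  shows "UGN R \<longleftrightarrow> UGN (identity_component G R A)"
proof -
  let ?S = "identity_component G R A"
  interpret group_graded_ring G R A
    using assms by (simp add: group_graded_ring_def group_graded_ring_axioms_def)
  have "\<exists>i f. i \<le> r \<and> f \<in> linear_maps ?S (right_component R (A g)) (right_power ?S i) \<and>
      bij_betw f (A g) ({..<i} \<rightarrow>\<^sub>E A \<one>\<^bsub>G\<^esub>)" if "g \<in> carrier G" for g
    using free[OF that]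
    by (auto simp: module_isomorphic_def right_component_def right_power_simps identity_component_def)
  then obtain \<rho> \<phi> where \<rho>: "\<And>g. g \<in> carrier G \<Longrightarrow> \<rho> g \<le> r"
    and \<phi>: "\<And>g. g \<in> carrier G \<Longrightarrow>
      \<phi> g \<in> linear_maps ?S (right_component R (A g)) (right_power ?S (\<rho> g))"
      "\<And>g. g \<in> carrier G \<Longrightarrow> bij_betw (\<phi> g) (A g) ({..<\<rho> g} \<rightarrow>\<^sub>E A \<one>\<^bsub>G\<^esub>)"
    by metis
  interpret free_group_graded_ring G R A \<rho> \<phi>
    by unfold_locales (fact \<phi>)+
  show ?thesis
    using UGN_identity_component UGN_of_identity_component[OF assms(2) _ \<rho>] by blast
qed

theorem corollaryA:
  fixes G :: "('g, 'h) monoid_scheme"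
    and R :: "('r, 'k) ring_scheme"
    and A :: "'g \<Rightarrow> 'r set"
  assumes "group G"
    and "supramenable G"
    and "ring R"
    and "group_grading G R A"
    and "boundedly_free G R A"
  shows "UGN R \<longleftrightarrow> UGN (identity_component G R A)"
proof -
  let ?S = "identity_component G R A"
  interpret group_graded_ring G R A
    using assms by (simp add: group_graded_ring_def group_graded_ring_axioms_def)
  obtain r where "(\<forall>g\<in>carrier G. \<exists>i\<in>{0..r}.
        module_isomorphic ?S (right_component R (A g)) (right_power ?S i)) \<or>
      (\<forall>g\<in>carrier G. \<exists>i\<in>{0..r}.
        module_isomorphic ?S (left_component R (A g)) (left_power ?S i))"
    using assms(5) unfolding boundedly_free_def Let_def by blast
  then show ?thesis
  proof
    assume "\<forall>g\<in>carrier G. \<exists>i\<in>{0..r}.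
        module_isomorphic ?S (right_component R (A g)) (right_power ?S i)"
    then show ?thesis using UGN_iff_of_right_free[OF assms(1-4)] by blast
  next
    assume left: "\<forall>g\<in>carrier G. \<exists>i\<in>{0..r}.
        module_isomorphic ?S (left_component R (A g)) (left_power ?S i)"
    have iso: "module_isomorphic (opposite ?S) = module_isomorphic ?S"
      unfolding module_isomorphic_def right_module_opposite ..
    have "UGN (opposite R) \<longleftrightarrow> UGN (identity_component (opposite G) (opposite R) A)"
    proof (rule UGN_iff_of_right_free)
      fix g assume "g \<in> carrier (opposite G)"
      then show "\<exists>i\<in>{0..r}. module_isomorphic (identity_component (opposite G) (opposite R) A)
        (right_component (opposite R) (A g)) (right_power (identity_component (opposite G) (opposite R) A) i)"
        using left unfolding identity_component_opposite right_module_opposite iso by simp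
    qed (use assms group_opposite supramenable_opposite ring_opposite group_grading_opposite in blast)+
    then show ?thesis
      using UGN_opposite[OF assms(3)] UGN_opposite[OF ring_identity_component]
      by (simp only: identity_component_opposite)
  qed
qed

end
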